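(* Let $E$ be a de Branges function and let $\widetilde\Pi_E$ be the orthogonal projection of $L_2(\mathbb R)$ onto $\mathcal B_E=\{F/E : F\in B(E)\}$. Then the determinantal point process $\mathbb P_{\widetilde\Pi_E}$ on $\mathbb R$ is rigid in the sense of Ghosh and Peres: for every bounded Borel set $B\subset\mathbb R$, the random variable $\#_B$ is $\mathcal F^{\mathbb P_{\widetilde\Pi_E}}_{\mathbb R\setminus B}$-measurable.
   Context: A de Branges function is an entire function $E$ with $|E(z)|>|E^{\#}(z)|$ for all $z$ in the open upper half-plane $\mathbb C_+$, where $E^{\#}(z)=\overline{E(\bar z)}$. The de Branges space $B(E)$ is the Hilbert space of entire functions $f$ such that $f|_{\mathbb R}\in L^2(\mathbb R,|E(\lambda)|^{-2}d\lambda)$ and $f/E$, $f^{\#}/E$ belong to the Hardy space $H_2(\mathbb C_+)$, with norm $\|f\|^2=\int_{\mathbb R}|f(\lambda)|^2|E(\lambda)|^{-2}d\lambda$. The space $\mathcal B_E=\{F/E: F\in B(E)\}$ (restricted to $\mathbb R$) is a closed subspace of $L_2(\mathbb R)$, and the orthogonal projection $\widetilde\Pi_E$ onto it has kernel $\widetilde\Pi_E(x,y)=\dfrac{E(x)\overline{E(y)}-E^{\#}(x)\overline{E^{\#}(y)}}{-2\pi i(x-y)E(x)\overline{E(y)}}$ for real $x\neq y$ (extended continuously to the diagonal). For a locally trace class operator $K$ on $L_2(\mathbb R)$, $\mathbb P_K$ denotes the determinantal point process on the space $\mathrm{Conf}(\mathbb R)$ of locally finite configurations, i.e. the unique Borel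 probability measure with $\mathbb E\prod_{x\in X}g(x)=\det(1+(g-1)K\chi_B)$ for every bounded measurable $g$ with $g-1$ supported in a bounded set $B$. For a bounded Borel $B$, $\#_B(X)$ is the number of points of $X$ in $B$; for Borel $C\subset\mathbb R$, $\mathcal F_C$ is the $\sigma$-algebra generated by $\#_{B}$, $B\subset C$ bounded Borel, and $\mathcal F_C^{\mathbb P}$ is its $\mathbb P$-completion. *)

theory Defs
  imports "HOL-Probability.Probability"
begin

definition sharp :: "(complex \<Rightarrow> complex) \<Rightarrow> complex \<Rightarrow> complex" where
  "sharp E z = cnj (E (cnj z))"

definition de_branges_function :: "(complex \<Rightarrow> complex) \<Rightarrow> bool" where
  "de_branges_function E \<longleftrightarrow>
     E holomorphic_on UNIV \<and> (\<forall>z. 0 < Im z \<longrightarrow> cmod (sharp E z) < cmod (E z))"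

text \<open>Off-diagonal kernel of the orthogonal projection of L2(R) onto B_E = F/E, F in B(E).\<close>
definition db_kernel0 :: "(complex \<Rightarrow> complex) \<Rightarrow> real \<Rightarrow> real \<Rightarrow> complex" where
  "db_kernel0 E x y =
     (E (of_real x) * cnj (E (of_real y)) - sharp E (of_real x) * cnj (sharp E (of_real y)))
     / (- 2 * of_real pi * \<i> * of_real (x - y) * E (of_real x) * cnj (E (of_real y)))"

definition db_kernel :: "(complex \<Rightarrow> complex) \<Rightarrow> real \<Rightarrow> real \<Rightarrow> complex" where
  "db_kernel E x y = (if x \<noteq> y then db_kernel0 E x y else Lim (at x) (\<lambda>t. db_kernel0 E x t))"

definition Conf :: "real set set" where
  "Conf = {X. \<forall>B. bounded B \<longrightarrow> finite (X \<inter> B)}"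

definition cnt :: "real set \<Rightarrow> real set \<Rightarrow> nat" where
  "cnt B X = card (X \<inter> B)"

definition conf_generators :: "real set \<Rightarrow> real set set set" where
  "conf_generators C =
     {cnt B -` {k} \<inter> Conf | B k. B \<in> sets borel \<and> bounded B \<and> B \<subseteq> C}"

definition conf_sigma :: "real set \<Rightarrow> real set measure" where
  "conf_sigma C = sigma Conf (conf_generators C)"

definition completed_sets :: "real set measure \<Rightarrow> real set \<Rightarrow> real set set set" where
  "completed_sets P C =
     {A. A \<subseteq> Conf \<and> (\<exists>S \<in> sets (conf_sigma C). \<exists>N \<in> null_sets P. (A - S) \<union> (S - A) \<subseteq> N)}"

definition point_process :: "real set measure \<Rightarrow> bool" where
  "point_process P \<longleftrightarrow> prob_space P \<and> space P = Conf \<and> sets P = sets (conf_sigma UNIV)"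

definition leibniz_det :: "nat \<Rightarrow> (nat \<Rightarrow> nat \<Rightarrow> complex) \<Rightarrow> complex" where
  "leibniz_det n M = (\<Sum>p | p permutes {..<n}. of_int (sign p) * (\<Prod>i<n. M i (p i)))"

text \<open>n-th term of the Fredholm series of det(1 + (g-1) K chi_B).\<close>
definition fredholm_term ::
  "(real \<Rightarrow> real \<Rightarrow> complex) \<Rightarrow> (real \<Rightarrow> complex) \<Rightarrow> real set \<Rightarrow> nat \<Rightarrow> complex" where
  "fredholm_term K g B n =
     (1 / of_real (fact n)) *
     (LINT x | PiM {..<n} (\<lambda>_. lborel).
        indicator (PiE {..<n} (\<lambda>_. B)) x *\<^sub>R
        leibniz_det n (\<lambda>i j. (g (x i) - 1) * K (x i) (x j) * indicator B (x j)))"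

definition determinantal :: "real set measure \<Rightarrow> (real \<Rightarrow> real \<Rightarrow> complex) \<Rightarrow> bool" where
  "determinantal P K \<longleftrightarrow> point_process P \<and>
     (\<forall>(g :: real \<Rightarrow> complex) B.
        g \<in> borel_measurable borel \<and> bounded (range g) \<and> B \<in> sets borel \<and> bounded B \<and>
        (\<forall>x. x \<notin> B \<longrightarrow> g x = 1) \<longrightarrow>
        fredholm_term K g B sums (\<integral>X. (\<Prod>x\<in>X \<inter> B. g x) \<partial>P))"

definition rigid :: "real set measure \<Rightarrow> bool" where
  "rigid P \<longleftrightarrow>
     (\<forall>B. B \<in> sets borel \<and> bounded B \<longrightarrow>
        cnt B \<in> measurable (sigma Conf (completed_sets P (UNIV - B))) (count_space UNIV))"

end

theory Submission
  imports Defs "HOL-Complex_Analysis.Complex_Analysis"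
begin

text \<open>
  For real arguments the kernel is \<open>(1 - \<Theta>(x) \<Theta>(y)\<^sup>*) / (- 2\<pi>\<i>(x - y))\<close> with the inner function
  \<open>\<Theta> = E\<^sup># / E\<close>, unimodular on the real line; hence \<open>\<bar>K(x,y)\<bar> \<le> 1 / \<bar>x - y\<bar>\<close>. Integrating
  \<open>((u(z) - 1) / (z - x) - u'(x)) / (z - x)\<close>, \<open>u = \<Theta> \<Theta>(x)\<^sup>*\<close>, over large half discs gives
  \<open>\<integral>\<bar>K(x,y)\<bar>\<^sup>2 dy = K(x,x)\<close>. Consequently the variance of a linear statistic \<open>\<Sum>f(x)\<close> is at most
  \<open>1/2 \<integral>\<integral>\<bar>f(x) - f(y)\<bar>\<^sup>2 \<bar>K(x,y)\<bar>\<^sup>2\<close>, which is dominated by the scale invariant energy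
  \<open>\<integral>\<integral>((f(x) - f(y)) / (x - y))\<^sup>2\<close>. Compactly supported \<open>f\<close> equal to 1 on a given bounded set can have
  arbitrarily small energy, and the criterion of Ghosh and Peres applies.
\<close>

section \<open>Cutoff functions of small energy\<close>

text \<open>Up to a constant the energy is the squared homogeneous Sobolev norm of order 1/2, the
  critical one on the line: stretching a fixed profile leaves it unchanged, so a single trapezoid
  made wider and wider never becomes cheap. The descent has to be spread over many scales; a
  minimisation argument takes the place of an explicit logarithmic profile. The projection enters
  only through the diagonal case of \<open>K K = K\<close>. Integrated against
  \<open>f(x)^2\<close>, it matches the diagonal part of the variance with the pair part, and only
  differences \<open>f(x) - f(y)\<close> survive. Half discs can prove that case because \<Theta> is
  bounded by 1 above the real axis and continues analytically across it. Two degeneracies shape the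
  rest. \<open>E\<close> may have real zeros, where the quotient must be continued while the kernel
  formula divides by zero. And the process is known only through expectations of products, given as
  series, so that moments of sums must first be extracted from a generating function.\<close>

definition energy :: "(real \<Rightarrow> real) \<Rightarrow> ennreal" where
  "energy f = (\<integral>\<^sup>+z. ennreal (((f (fst z) - f (snd z)) / (fst z - snd z))\<^sup>2) \<partial>(lborel \<Otimes>\<^sub>M lborel))"

text \<open>The conditions define a convex class, which is what the minimisation relies on. The
  exact value 1 on the plateau later turns a weighted sum over points into a count.\<close>

definition cutoff :: "real \<Rightarrow> (real \<Rightarrow> real) \<Rightarrow> bool" where
  "cutoff R f \<longleftrightarrow> f \<in> borel_measurable borel \<and> (\<forall>x. 0 \<le> f x \<and> f x \<le> 1) \<and>
     (\<forall>x. \<bar>x\<bar> \<le> R \<longrightarrow> f x = 1) \<and> (\<exists>T. \<forall>x. T < \<bar>x\<bar> \<longrightarrow> f x = 0)"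

lemma cutoff_measurable [measurable_dest]: "cutoff R f \<Longrightarrow> f \<in> borel_measurable borel"
  by (simp add: cutoff_def)

lemma cutoff_mono: "cutoff R f \<Longrightarrow> r \<le> R \<Longrightarrow> cutoff r f"
  by (auto simp: cutoff_def)

lemma cutoff_midpoint:
  assumes "cutoff R f" "cutoff R g"
  shows "cutoff R (\<lambda>x. (f x + g x) / 2)"
proof -
  obtain S T where S: "\<And>x. S < \<bar>x\<bar> \<Longrightarrow> f x = 0" and T: "\<And>x. T < \<bar>x\<bar> \<Longrightarrow> g x = 0"
    using assms unfolding cutoff_def by blast
  have "\<forall>x. max S T < \<bar>x\<bar> \<longrightarrow> (f x + g x) / 2 = 0"
    using S T by auto
  moreover have "(\<lambda>x. (f x + g x) / 2) \<in> borel_measurable borel"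
    using assms[THEN cutoff_measurable] by measurable
  moreover have "0 \<le> (f x + g x) / 2 \<and> (f x + g x) / 2 \<le> 1" for x
  proof -
    have "0 \<le> f x" "f x \<le> 1" "0 \<le> g x" "g x \<le> 1"
      using assms unfolding cutoff_def by auto
    then show ?thesis
      by auto
  qed
  ultimately show ?thesis
    using assms unfolding cutoff_def by (intro conjI exI[of _ "max S T"]) auto
qed

text \<open>The energy is a quadratic form in \<open>f\<close>. The identity is stated with sums
  only, so that it also makes sense for infinite energies.\<close>

lemma energy_parallelogram:
  assumes [measurable]: "f \<in> borel_measurable borel" "g \<in> borel_measurable borel"
  shows "energy (\<lambda>x. f x - g x) + 4 * energy (\<lambda>x. (f x + g x) / 2) = 2 * energy f + 2 * energy g"
proof -
  let ?d = "\<lambda>f z. (f (fst z) - f (snd z)) / (fst z - snd z) :: real"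
  have alg: "(p - q)\<^sup>2 + 4 * ((p + q) / 2)\<^sup>2 = 2 * p\<^sup>2 + 2 * q\<^sup>2" for p q :: real
    by (simp add: power2_eq_square field_simps)
  have enn: "ennreal A + 4 * ennreal B = 2 * ennreal C + 2 * ennreal D"
    if "A + 4 * B = 2 * C + 2 * D" "0 \<le> A" "0 \<le> B" "0 \<le> C" "0 \<le> D" for A B C D
  proof -
    have "ennreal A + 4 * ennreal B = ennreal (A + 4 * B)"
      "2 * ennreal C + 2 * ennreal D = ennreal (2 * C + 2 * D)"
      using that(2-) by (simp_all add: ennreal_mult')
    then show ?thesis
      using that(1) by simp
  qed
  have eq: "ennreal ((?d (\<lambda>x. f x - g x) z)\<^sup>2) + 4 * ennreal ((?d (\<lambda>x. (f x + g x) / 2) z)\<^sup>2)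
        = 2 * ennreal ((?d f z)\<^sup>2) + 2 * ennreal ((?d g z)\<^sup>2)" for z
  proof -
    have "?d (\<lambda>x. f x - g x) z = ?d f z - ?d g z"
      "?d (\<lambda>x. (f x + g x) / 2) z = (?d f z + ?d g z) / 2"
      by (simp_all add: diff_divide_distrib[symmetric] add_divide_distrib[symmetric] algebra_simps)
    then have "(?d (\<lambda>x. f x - g x) z)\<^sup>2 + 4 * (?d (\<lambda>x. (f x + g x) / 2) z)\<^sup>2
        = 2 * (?d f z)\<^sup>2 + 2 * (?d g z)\<^sup>2"
      by (simp only: alg)
    then show ?thesis
      by (intro enn) simp_all
  qed
  let ?M = "lborel \<Otimes>\<^sub>M lborel :: (real \<times> real) measure"
  let ?q = "\<lambda>f z. ennreal ((?d f z)\<^sup>2)"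
  have [measurable]: "?q h \<in> borel_measurable ?M" if [measurable]: "h \<in> borel_measurable borel" for h
    by measurable
  have "energy (\<lambda>x. f x - g x) + 4 * energy (\<lambda>x. (f x + g x) / 2)
      = (\<integral>\<^sup>+z. ?q (\<lambda>x. f x - g x) z + 4 * ?q (\<lambda>x. (f x + g x) / 2) z \<partial>?M)"
    unfolding energy_def by (subst nn_integral_add) (auto simp: nn_integral_cmult)
  also have "\<dots> = (\<integral>\<^sup>+z. 2 * ?q f z + 2 * ?q g z \<partial>?M)"
    by (simp only: eq)
  also have "\<dots> = 2 * energy f + 2 * energy g"
    unfolding energy_def by (subst nn_integral_add) (auto simp: nn_integral_cmult)
  finally show ?thesis .
qed

text \<open>Fatou's lemma for the difference quotients: lower semicontinuity of the energy under
  plain pointwise convergence.\<close>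

lemma energy_le_liminf:
  assumes [measurable]: "\<And>k. h k \<in> borel_measurable borel"
    and lim: "\<And>x. (\<lambda>k. h k x) \<longlonglongrightarrow> h' x"
  shows "energy h' \<le> liminf (\<lambda>k. energy (h k))"
proof -
  \<comment> \<open>On the diagonal all quotients are 0 by division by zero, so convergence holds at
    every \<open>z\<close>.\<close>
  have "(\<lambda>k. ennreal (((h k (fst z) - h k (snd z)) / (fst z - snd z))\<^sup>2))
          \<longlonglongrightarrow> ennreal (((h' (fst z) - h' (snd z)) / (fst z - snd z))\<^sup>2)" for z
    by (cases "fst z = snd z") (auto intro!: tendsto_intros lim)
  then have eq: "ennreal (((h' (fst z) - h' (snd z)) / (fst z - snd z))\<^sup>2) =
     liminf (\<lambda>k. ennreal (((h k (fst z) - h k (snd z)) / (fst z - snd z))\<^sup>2))" for z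
    by (intro lim_imp_Liminf[symmetric]) auto
  show ?thesis
    unfolding energy_def eq by (rule nn_integral_liminf) measurable
qed

definition hat :: "real \<Rightarrow> real \<Rightarrow> real" where
  "hat r x = max 0 (min 1 (2 - \<bar>x\<bar> / r))"

lemma cutoff_hat: "0 < r \<Longrightarrow> cutoff r (hat r)"
proof -
  assume "0 < r"
  then have "hat r x = 0" if "2 * r < \<bar>x\<bar>" for x
    using that by (simp add: hat_def max_def min_def field_simps)
  moreover have "hat r x = 1" if "\<bar>x\<bar> \<le> r" for x
    using that \<open>0 < r\<close> by (simp add: hat_def max_def min_def field_simps)
  moreover have "hat r \<in> borel_measurable borel"
    unfolding hat_def[abs_def] by measurable
  ultimately show ?thesis
    unfolding cutoff_def by (auto simp: hat_def)
qed

text \<open>The difference of values is at most 1 and at most \<open>|x - y| / r\<close>. Hence the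
  squared quotient is below both \<open>1 / (x - y)^2\<close> and \<open>1 / r^2\<close>, and the
  minimum of \<open>1 / a\<close> and \<open>1 / b\<close> is at most
  \<open>2 / (a + b)\<close>.\<close>

lemma hat_quotient_bound:
  assumes "0 < r"
  shows "((hat r x - hat r y) / (x - y))\<^sup>2 \<le> 2 / (r\<^sup>2 + (x - y)\<^sup>2)"
proof (cases "x = y")
  case False
  define d where "d = \<bar>hat r x - hat r y\<bar>"
  have "\<bar>hat r x - hat r y\<bar> \<le> \<bar>\<bar>x\<bar> / r - \<bar>y\<bar> / r\<bar>"
    unfolding hat_def by linarith
  also have "\<dots> \<le> \<bar>x - y\<bar> / r"
    using assms by (simp add: divide_simps flip: diff_divide_distrib)
  finally have "d * r \<le> \<bar>x - y\<bar>" 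
    using assms by (simp add: d_def field_simps)
  then have 1: "d\<^sup>2 * r\<^sup>2 \<le> (x - y)\<^sup>2"
    using power_mono[of "d * r" "\<bar>x - y\<bar>" 2] assms by (simp add: d_def power_mult_distrib)
  have "d \<le> 1"
    unfolding d_def hat_def by linarith
  then have 2: "d\<^sup>2 \<le> 1"
    by (simp add: d_def abs_square_le_1)
  have "d\<^sup>2 * (r\<^sup>2 + (x - y)\<^sup>2) \<le> 2 * (x - y)\<^sup>2"
    using 1 mult_right_mono[OF 2, of "(x - y)\<^sup>2"] by (simp add: algebra_simps)
  then show ?thesis
    using False assms by (simp add: power_divide d_def divide_simps sum_power2_gt_zero_iff add_pos_nonneg mult.commute)
qed (simp add: assms)

text \<open>The integral equals \<open>2 * pi / r\<close>; the bound \<open>8 / r\<close> comes from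
  \<open>pi < 4\<close>.\<close>

lemma nn_integral_cauchy_density:
  assumes "0 < (r::real)"
  shows "(\<integral>\<^sup>+y. ennreal (2 / (r\<^sup>2 + (x - y)\<^sup>2)) \<partial>lborel) \<le> ennreal (8 / r)"
proof -
  let ?h = "\<lambda>y::real. 2 / (r\<^sup>2 + y\<^sup>2)"
  let ?F = "\<lambda>y. (2 / r) * arctan (y / r)"
  have D: "DERIV ?F y :> ?h y" for y
  proof -
    have "r\<^sup>2 + y\<^sup>2 > 0"
      using assms by (simp add: add_pos_nonneg)
    then have "2 / r * (inverse (1 + (y / r)\<^sup>2) * (1 / r)) = ?h y"
      using assms by (simp add: divide_simps power2_eq_square)
    moreover have "DERIV ?F y :> 2 / r * (inverse (1 + (y / r)\<^sup>2) * (1 / r))"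
      using assms by (auto intro!: derivative_eq_intros)
    ultimately show ?thesis
      by simp
  qed
  have lim: "(?F \<longlongrightarrow> (2 / r) * (pi / 2)) at_top"
    using assms
    by (intro tendsto_intros filterlim_compose[OF tendsto_arctan_at_top])
       (auto intro!: filterlim_tendsto_pos_mult_at_top filterlim_ident simp: divide_inverse mult.commute[of _ "inverse r"])
  have pos: "(\<integral>\<^sup>+y. ennreal (?h y) * indicator {0..} y \<partial>lborel) = ennreal (pi / r)"
    using nn_integral_FTC_atLeast[of ?h 0 ?F, OF _ D _ lim] assms by auto
  have "(\<integral>\<^sup>+y. ennreal (2 / (r\<^sup>2 + (x - y)\<^sup>2)) \<partial>lborel) = (\<integral>\<^sup>+y. ennreal (?h y) \<partial>lborel)"
    by (subst nn_integral_real_affine[of _ "-1" x]) (auto)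
  also have "\<dots> \<le> (\<integral>\<^sup>+y. ennreal (?h y) * indicator {0..} y + ennreal (?h (-y)) * indicator {0..} (-y) \<partial>lborel)"
    by (intro nn_integral_mono) (auto simp: indicator_def)
  also have "\<dots> = (\<integral>\<^sup>+y. ennreal (?h y) * indicator {0..} y \<partial>lborel)
     + (\<integral>\<^sup>+y. ennreal (?h (-y)) * indicator {0..} (-y) \<partial>lborel)"
    by (intro nn_integral_add) auto
  also have "(\<integral>\<^sup>+y. ennreal (?h (-y)) * indicator {0..} (-y) \<partial>lborel) = (\<integral>\<^sup>+y. ennreal (?h y) * indicator {0..} y \<partial>lborel)"
    using nn_integral_real_affine[of "\<lambda>y. ennreal (?h y) * indicator {0..} y" "-1" 0] by simp
  finally have "(\<integral>\<^sup>+y. ennreal (2 / (r\<^sup>2 + (x - y)\<^sup>2)) \<partial>lborel) \<le> ennreal (2 * (pi / r))"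
    unfolding pos using assms by (simp flip: ennreal_plus)
  also have "2 * (pi / r) \<le> 8 / r"
    using assms pi_less_4 by (simp add: divide_simps)
  finally show ?thesis
    by (simp add: ennreal_leI)
qed

text \<open>A nonzero difference forces \<open>x\<close> or \<open>y\<close> into an interval of
  length \<open>4 * r\<close>; integrating out the other variable costs at most
  \<open>8 / r\<close>. Each case contributes 32. That \<open>r\<close> cancels is the point: one
  bound serves plateaus of every size.\<close>

lemma energy_hat: 
  assumes "0 < r"
  shows "energy (hat r) \<le> ennreal 64"
proof -
  let ?I = "indicator {-2*r..2*r} :: real \<Rightarrow> ennreal"
  let ?h = "\<lambda>x y. ennreal (2 / (r\<^sup>2 + (x - y)\<^sup>2))"
  have zero: "hat r x = 0" if "x \<notin> {-2*r..2*r}" for x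
    using that assms by (auto simp: hat_def max_def min_def field_simps abs_if)
  have le: "ennreal (((hat r x - hat r y) / (x - y))\<^sup>2) \<le> ?I x * ?h x y + ?I y * ?h y x" for x y
  proof (cases "x \<in> {-2*r..2*r}")
    case True
    then show ?thesis
      using ennreal_leI[OF hat_quotient_bound[OF assms, of x y]]
      by (simp add: add_increasing2)
  next
    case x: False
    show ?thesis
    proof (cases "y \<in> {-2*r..2*r}")
      case True
      then show ?thesis
        using ennreal_leI[OF hat_quotient_bound[OF assms, of x y]]
        by (simp add: add_increasing power2_commute[of y x])
    qed (use x in \<open>simp add: zero\<close>)
  qed
  have mass: "(\<integral>\<^sup>+x. ?I x * ennreal (8 / r) \<partial>lborel) = ennreal 32"
    using assms by (simp add: nn_integral_multc flip: ennreal_mult)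
  have half: "(\<integral>\<^sup>+x. (\<integral>\<^sup>+y. ?I x * ?h x y \<partial>lborel) \<partial>lborel) \<le> ennreal 32"
  proof -
    have "(\<integral>\<^sup>+x. (\<integral>\<^sup>+y. ?I x * ?h x y \<partial>lborel) \<partial>lborel) = (\<integral>\<^sup>+x. ?I x * (\<integral>\<^sup>+y. ?h x y \<partial>lborel) \<partial>lborel)"
      by (simp add: nn_integral_cmult)
    also have "\<dots> \<le> (\<integral>\<^sup>+x. ?I x * ennreal (8 / r) \<partial>lborel)"
      by (intro nn_integral_mono mult_left_mono nn_integral_cauchy_density assms) auto
    finally show ?thesis
      unfolding mass .
  qed
  have "energy (hat r) \<le> (\<integral>\<^sup>+z. ?I (fst z) * ?h (fst z) (snd z) + ?I (snd z) * ?h (snd z) (fst z) \<partial>(lborel \<Otimes>\<^sub>M lborel))"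
    unfolding energy_def by (intro nn_integral_mono le)
  also have "\<dots> = (\<integral>\<^sup>+z. ?I (fst z) * ?h (fst z) (snd z) \<partial>(lborel \<Otimes>\<^sub>M lborel))
      + (\<integral>\<^sup>+z. ?I (snd z) * ?h (snd z) (fst z) \<partial>(lborel \<Otimes>\<^sub>M lborel))"
    by (intro nn_integral_add) measurable
  also have "(\<integral>\<^sup>+z. ?I (fst z) * ?h (fst z) (snd z) \<partial>(lborel \<Otimes>\<^sub>M lborel)) \<le> ennreal 32"
    using half by (subst lborel.nn_integral_fst[symmetric]) auto
  also have "(\<integral>\<^sup>+z. ?I (snd z) * ?h (snd z) (fst z) \<partial>(lborel \<Otimes>\<^sub>M lborel)) \<le> ennreal 32"
    using half by (subst lborel_pair.nn_integral_snd[symmetric]) auto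
  finally show ?thesis
    by (simp add: add_right_mono flip: ennreal_plus)
qed

text \<open>The infimum \<open>m n\<close> of the energy over cutoffs equal to 1 on \<open>[-n-1, n+1]\<close> increases with \<open>n\<close> and is bounded,
  so near-minimisers \<open>g n\<close> form a Cauchy sequence by the parallelogram law. Since \<open>g k \<longrightarrow> 1\<close> pointwise and
  constants carry no energy, Fatou yields \<open>energy (g n) \<longrightarrow> 0\<close>.\<close>
lemma exists_cutoff_small_energy:
  fixes R \<epsilon> :: real
  assumes "0 < \<epsilon>"
  shows "\<exists>f. cutoff R f \<and> energy f \<le> ennreal \<epsilon>"
proof -
  define m where "m n = (INF f\<in>{f. cutoff (real (Suc n)) f}. energy f)" for n
  define e where "e n = inverse (real (Suc n))" for n
  have m_le: "m n \<le> ennreal 64" for n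
    unfolding m_def by (rule INF_lower2[of "hat (real (Suc n))"]) (auto intro!: cutoff_hat energy_hat simp del: ennreal_numeral)
  define a where "a n = enn2real (m n)" for n
  have m_eq: "m n = ennreal (a n)" for n
    unfolding a_def using m_le[of n] by (intro ennreal_enn2real[symmetric]) (metis ennreal_less_top order_le_less_trans)
  have a0: "0 \<le> a n" for n by (simp add: a_def)
  have e0: "0 < e n" for n by (simp add: e_def)
  have "\<exists>g. cutoff (real (Suc n)) g \<and> energy g < ennreal (a n + e n)" for n
  proof -
    have "m n < ennreal (a n + e n)"
      unfolding m_eq using a0 e0 by (simp add: ennreal_less_iff)
    then show ?thesis
      unfolding m_def by (auto simp: INF_less_iff)
  qed
  then obtain g where g: "\<And>n. cutoff (real (Suc n)) (g n)" "\<And>n. energy (g n) < ennreal (a n + e n)"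
    by metis
  note [measurable] = g(1)[THEN cutoff_measurable]
  define b where "b n = enn2real (energy (g n))" for n
  have b: "energy (g n) = ennreal (b n)" "0 \<le> b n" "b n < a n + e n" for n
  proof -
    show eq: "energy (g n) = ennreal (b n)"
      unfolding b_def using g(2)[of n] by (intro ennreal_enn2real[symmetric]) (auto simp: order_less_trans)
    show "0 \<le> b n" by (simp add: b_def)
    then show "b n < a n + e n"
      using g(2)[of n] unfolding eq by (simp add: ennreal_less_iff)
  qed
  have "incseq m"
    unfolding m_def by (intro incseq_SucI INF_superset_mono) (auto intro: cutoff_mono)
  then have a_mono: "a i \<le> a j" if "i \<le> j" for i j
    using that incseqD[of m i j] a0 by (simp add: m_eq ennreal_le_iff)
  have "bdd_above (range a)"
    using m_le unfolding m_eq
    by (intro bdd_aboveI[of _ 64]) (auto simp: ennreal_le_iff simp del: ennreal_numeral)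
  with a_mono have "a \<longlonglongrightarrow> (SUP i. a i)"
    by (intro LIMSEQ_incseq_SUP) (auto simp: incseq_def)
  then obtain \<alpha> where \<alpha>: "a \<longlonglongrightarrow> \<alpha>"
    by blast
  then have a_le: "a n \<le> \<alpha>" for n
    using a_mono by (intro incseq_le) (auto simp: incseq_def)
  have e_mono: "e k \<le> e n" if "n \<le> k" for n k
    using that by (simp add: e_def divide_simps)
  \<comment> \<open>The midpoint of \<open>g n\<close> and \<open>g k\<close> is again a competitor
    for \<open>m n\<close>, so its energy is at least \<open>a n\<close>. The parallelogram law then
    bounds the energy of the difference by \<open>2 * b n + 2 * b k - 4 * a n\<close>, and
    \<open>b n < a n + e n\<close>, \<open>b k < a k + e k\<close>,
    \<open>a k \<le> \<alpha>\<close>, \<open>e k \<le> e n\<close> give the constants.\<close>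
  have diff: "energy (\<lambda>x. g n x - g k x) \<le> ennreal (2 * (\<alpha> - a n) + 4 * e n)" if "n \<le> k" for n k
  proof -
    let ?d = "energy (\<lambda>x. g n x - g k x)" and ?c = "energy (\<lambda>x. (g n x + g k x) / 2)"
    have "cutoff (real (Suc n)) (\<lambda>x. (g n x + g k x) / 2)"
      using that by (intro cutoff_midpoint g(1) cutoff_mono[OF g(1)[of k]]) auto
    then have "ennreal (a n) \<le> ?c"
      unfolding m_eq[symmetric] m_def by (intro INF_lower) auto
    then have "?d + 4 * ennreal (a n) \<le> ?d + 4 * ?c"
      by (intro add_left_mono mult_left_mono) auto
    also have "\<dots> = ennreal (2 * b n + 2 * b k)"
      using b(2) by (subst energy_parallelogram) (auto simp: b(1) ennreal_mult')
    finally have *: "?d + ennreal (4 * a n) \<le> ennreal (2 * b n + 2 * b k)"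
      using a0 by (simp add: ennreal_mult')
    then have "?d < \<top>"
      using order_le_less_trans[OF * ennreal_less_top] by (simp add: less_top)
    then obtain d where d: "?d = ennreal d" "0 \<le> d"
      by (cases ?d) auto
    have "d + 4 * a n \<le> 2 * b n + 2 * b k"
      using * d a0[of n] b(2)[of n] b(2)[of k]
      by (simp add: ennreal_le_iff flip: ennreal_plus)
    then have "d \<le> 2 * (\<alpha> - a n) + 4 * e n"
      using b(3)[of n] b(3)[of k] e_mono[OF that] a_le[of k] by (simp add: algebra_simps)
    then show ?thesis
      unfolding d(1) by (rule ennreal_leI)
  qed
  have to_1: "(\<lambda>k. g k x) \<longlonglongrightarrow> 1" for x
  proof -
    have "eventually (\<lambda>k. \<bar>x\<bar> \<le> real (Suc k)) sequentially"
      by (rule eventually_sequentiallyI[of "nat \<lceil>\<bar>x\<bar>\<rceil>"]) linarith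
    then have "eventually (\<lambda>k. g k x = 1) sequentially"
      by eventually_elim (use g(1) in \<open>auto simp: cutoff_def\<close>)
    then show ?thesis
      by (rule tendsto_eventually)
  qed
  have small: "energy (g n) \<le> ennreal (2 * (\<alpha> - a n) + 4 * e n)" for n
  proof -
    have "energy (g n) = energy (\<lambda>x. g n x - 1)"
      by (simp add: energy_def)
    also have "\<dots> \<le> liminf (\<lambda>k. energy (\<lambda>x. g n x - g k x))"
      by (intro energy_le_liminf tendsto_intros to_1) measurable
    also have "\<dots> \<le> limsup (\<lambda>k. energy (\<lambda>x. g n x - g k x))"
      by (intro Liminf_le_Limsup) auto
    also have "\<dots> \<le> ennreal (2 * (\<alpha> - a n) + 4 * e n)"
      by (intro Limsup_bounded eventually_sequentiallyI[of n] diff)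
    finally show ?thesis .
  qed
  have "e \<longlonglongrightarrow> 0"
    unfolding e_def by (rule LIMSEQ_inverse_real_of_nat)
  then have "(\<lambda>n. 2 * (\<alpha> - a n) + 4 * e n) \<longlonglongrightarrow> 2 * (\<alpha> - \<alpha>) + 4 * 0"
    by (intro tendsto_intros \<alpha>)
  then have "eventually (\<lambda>n. 2 * (\<alpha> - a n) + 4 * e n < \<epsilon>) sequentially"
    using assms by (auto dest!: order_tendstoD(2)[of _ _ _ \<epsilon>])
  moreover have "eventually (\<lambda>n. R \<le> real (Suc n)) sequentially"
    by (rule eventually_sequentiallyI[of "nat \<lceil>R\<rceil>"]) linarith
  ultimately have "eventually (\<lambda>n. 2 * (\<alpha> - a n) + 4 * e n < \<epsilon> \<and> R \<le> real (Suc n)) sequentially"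
    by (rule eventually_conj)
  then obtain n where n: "2 * (\<alpha> - a n) + 4 * e n < \<epsilon>" "R \<le> real (Suc n)"
    by (auto simp: eventually_sequentially)
  have "cutoff R (g n)" "energy (g n) \<le> ennreal \<epsilon>"
    using n cutoff_mono[OF g(1)[of n]] order_trans[OF small[of n] ennreal_leI] by auto
  then show ?thesis
    by blast
qed

section \<open>The inner function of a de Branges function\<close>

lemma sharp_holomorphic: "E holomorphic_on UNIV \<Longrightarrow> sharp E holomorphic_on UNIV"
  using holomorphic_on_compose_cnj_cnj[of E UNIV] holomorphic_on_subset[of E UNIV "range cnj"]
  by (simp add: sharp_def[abs_def] o_def)

lemma filterlim_of_real_at_complex: "filterlim complex_of_real (at (complex_of_real x)) (at x)"
  by (auto simp: filterlim_at eventually_at_filter intro!: tendsto_intros)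

text \<open>The strict inequality at \<open>\<i>\<close> shows that \<open>E\<close> is not
  identically zero. Real zeros remain possible, and this isolates them.\<close>

lemma de_branges_zeros_isolated:
  assumes "de_branges_function E"
  shows "eventually (\<lambda>z. E z \<noteq> 0) (at a)"
proof (cases "E a = 0")
  case True
  have "E \<i> \<noteq> 0"
    using assms unfolding de_branges_function_def by (force dest: spec[of _ \<i>])
  then obtain r where "0 < r" "\<And>z. z \<in> ball a r - {a} \<Longrightarrow> E z \<noteq> 0"
    using isolated_zeros[of E UNIV a \<i>] assms True unfolding de_branges_function_def by auto
  then show ?thesis
    unfolding eventually_at by (intro exI[of _ r]) (auto simp: dist_commute)
next
  case False
  have "continuous_on UNIV E"
    using assms unfolding de_branges_function_def by (auto intro: holomorphic_on_imp_continuous_on)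
  then have "isCont E a"
    by (simp add: continuous_on_eq_continuous_at)
  with False show ?thesis
    by (metis isCont_def tendsto_imp_eventually_ne)
qed

text \<open>In the open half-plane \<open>E\<close> has no zeros. At a real zero of \<open>E\<close>
  the quotient cannot have a pole, because it has modulus 1 at all nearby real points; the
  singularity is removable, and continuity carries modulus 1 over to the filled-in value.\<close>

lemma de_branges_quotient:
  assumes E: "de_branges_function E"
  obtains T where "T analytic_on {z. 0 \<le> Im z}" "\<And>z. 0 \<le> Im z \<Longrightarrow> cmod (T z) \<le> 1"
    "\<And>x::real. cmod (T x) = 1" "\<And>x::real. E x \<noteq> 0 \<Longrightarrow> T x = sharp E x / E x"
proof -
  define f where "f z = sharp E z / E z" for z
  have hol: "E holomorphic_on UNIV" "sharp E holomorphic_on UNIV"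
    using E sharp_holomorphic unfolding de_branges_function_def by auto
  have ana: "f analytic_on {z}" if "E z \<noteq> 0" for z
    unfolding f_def using hol that
    by (intro analytic_on_divide) (auto intro: holomorphic_on_imp_analytic_at)
  have "f meromorphic_on UNIV"
    unfolding f_def using hol
    by (intro meromorphic_on_divide analytic_on_imp_meromorphic_on) (auto simp: analytic_on_open)
  then have iso: "isolated_singularity_at f z" and ness: "not_essential f z" for z
    by (auto intro: meromorphic_on_isolated_singularity meromorphic_on_not_essential meromorphic_on_subset)
  have upper: "E z \<noteq> 0 \<and> cmod (f z) < 1" if "0 < Im z" for z
  proof -
    have "cmod (sharp E z) < cmod (E z)"
      using E that unfolding de_branges_function_def by auto
    then show ?thesis
      by (auto simp: f_def norm_divide divide_simps)
  qed
  have real: "cmod (f (of_real x)) = 1" if "E (of_real x) \<noteq> 0" for x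
    using that by (simp add: f_def norm_divide sharp_def)
  have ev_real: "eventually (\<lambda>x. E (of_real x) \<noteq> 0) (at x)" for x
    using eventually_compose_filterlim[OF de_branges_zeros_isolated[OF E] filterlim_of_real_at_complex] .
  define T where "T = remove_sings f"
  have T_eq: "T z = f z" if "E z \<noteq> 0" for z
    unfolding T_def using ana[OF that] by simp
  have T_real: "T analytic_on {complex_of_real x}" for x
  proof -
    have "\<not> is_pole f (of_real x)"
    proof
      assume "is_pole f (of_real x)"
      then have "filterlim f at_infinity (at (complex_of_real x))"
        by (simp add: is_pole_def)
      then have "filterlim (\<lambda>t. f (of_real t)) at_infinity (at x)"
        using filterlim_of_real_at_complex by (rule filterlim_compose)
      then have "eventually (\<lambda>t. 2 \<le> cmod (f (of_real t))) (at x)"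
        by (auto simp: filterlim_at_infinity[of 0])
      with ev_real[of x] have "eventually (\<lambda>t. False) (at x)"
        by eventually_elim (use real in force)
      then show False
        by simp
    qed
    then obtain c where "f \<midarrow>of_real x\<rightarrow> c"
      using ness[of "of_real x"] unfolding not_essential_def by auto
    then show ?thesis
      unfolding T_def by (intro remove_sings_analytic_at iso)
  qed
  have T_ana: "T analytic_on {z}" if "0 \<le> Im z" for z
  proof (cases "0 < Im z")
    case True
    then show ?thesis
      unfolding T_def using ana upper by (intro remove_sings_analytic_on) auto
  next
    case False
    then have "z = of_real (Re z)"
      using that by (simp add: complex_eq_iff)
    then show ?thesis
      using T_real by metis
  qed
  have T_unit: "cmod (T (of_real x)) = 1" for x
  proof -
    have "isCont T (of_real x)"
      using T_real analytic_at_imp_isCont by blast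
    then have "((\<lambda>t. T (of_real t)) \<longlongrightarrow> T (of_real x)) (at x)"
      unfolding isCont_def using filterlim_of_real_at_complex by (rule filterlim_compose)
    then have lim: "((\<lambda>t. cmod (T (of_real t))) \<longlongrightarrow> cmod (T (of_real x))) (at x)"
      by (intro tendsto_intros)
    have "eventually (\<lambda>t. cmod (T (of_real t)) = 1) (at x)"
      using ev_real[of x] by eventually_elim (simp add: T_eq real)
    then have "((\<lambda>t. cmod (T (of_real t))) \<longlongrightarrow> 1) (at x)"
      by (rule tendsto_eventually)
    with lim show ?thesis
      by (intro tendsto_unique[OF _ lim]) auto
  qed
  show ?thesis
  proof (rule that)
    show "T analytic_on {z. 0 \<le> Im z}"
      using T_ana by (subst analytic_on_analytic_at) auto
    show "cmod (T z) \<le> 1" if "0 \<le> Im z" for z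
    proof (cases "0 < Im z")
      case True
      then show ?thesis using upper[of z] T_eq by auto
    next
      case False
      then have "z = of_real (Re z)"
        using that by (simp add: complex_eq_iff)
      then show ?thesis
        using T_unit by (metis order_refl)
    qed
  qed (use T_unit T_eq in \<open>auto simp: f_def\<close>)
qed

section \<open>The kernel of an inner function on the real line\<close>

locale inner_function =
  fixes T :: "complex \<Rightarrow> complex"
  assumes analytic: "T analytic_on {z. 0 \<le> Im z}"
    and bound: "\<And>z. 0 \<le> Im z \<Longrightarrow> cmod (T z) \<le> 1"
    and unimodular [simp]: "\<And>x. cmod (T (of_real x)) = 1"
begin

text \<open>Writing \<open>T = exp (\<i> \<phi>)\<close> on the real line, the diagonal value is
  \<open>\<phi>' / (2 pi)\<close>, the limit of the off-diagonal expression.\<close>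

definition kern :: "real \<Rightarrow> real \<Rightarrow> complex" where
  "kern x y = (if x = y then \<i> * T x * cnj (deriv T x) / (2 * pi)
     else (1 - T x * cnj (T y)) / (- 2 * pi * \<i> * (x - y)))"

lemma DERIV_T: "(T has_field_derivative deriv T (of_real x)) (at (of_real x))"
  using analytic by (intro analytic_derivI analytic_on_subset[OF analytic]) auto

lemma isCont_T: "isCont T (of_real x)"
  using DERIV_T DERIV_isCont by blast

lemma isCont_deriv_T: "isCont (deriv T) (of_real x)"
  by (intro analytic_at_imp_isCont analytic_deriv analytic_on_subset[OF analytic]) auto

lemma continuous_T: "continuous_on A (\<lambda>x. T (complex_of_real x))"
  by (rule continuous_on_compose2[of "range complex_of_real"])
    (auto intro!: continuous_at_imp_continuous_on isCont_T continuous_intros)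

lemma continuous_deriv_T: "continuous_on A (\<lambda>x. deriv T (complex_of_real x))"
  by (rule continuous_on_compose2[of "range complex_of_real"])
    (auto intro!: continuous_at_imp_continuous_on isCont_deriv_T continuous_intros)

lemma T_mult_cnj [simp]: "T (of_real x) * cnj (T (of_real x)) = 1"
  by (simp add: complex_norm_square[symmetric])

lemma difference_quotient_tendsto:
  "((\<lambda>t. (T (of_real t) - T (of_real x)) / of_real (t - x)) \<longlongrightarrow> deriv T (of_real x)) (at x)"
proof -
  have "((\<lambda>z. (T z - T (of_real x)) / (z - of_real x)) \<longlongrightarrow> deriv T (of_real x)) (at (of_real x))"
    using DERIV_T[of x] by (simp add: has_field_derivative_iff)
  from filterlim_compose[OF this filterlim_of_real_at_complex] show ?thesis
    by simp
qed

text \<open>Replacing 1 by \<open>T x * cnj (T x)\<close> exposes a difference quotient of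
  \<open>T\<close>. The limit at the diagonal and the local bound can both be read off from this
  form.\<close>

lemma kern_offdiag:
  assumes "x \<noteq> y"
  shows "kern x y = \<i> / (2 * pi) * (T x * cnj ((T y - T x) / of_real (y - x)))"
proof -
  have "1 - T x * cnj (T y) = T x * cnj (T x) - T x * cnj (T y)"
    by simp
  also have "\<dots> = - (T x * cnj (T y - T x))"
    by (simp add: algebra_simps del: T_mult_cnj)
  finally have *: "1 - T x * cnj (T y) = - (T x * cnj (T y - T x))" .
  have ne: "complex_of_real x \<noteq> complex_of_real y"
    using assms by simp
  have "a / (- 2 * pi * \<i> * (x - y)) = \<i> / (2 * pi) * (- a / of_real (y - x))" for a
    using ne by (simp add: divide_simps)
  then show ?thesis
    using assms unfolding kern_def * by simp
qed

lemma kern_tendsto: "((\<lambda>t. kern x t) \<longlongrightarrow> kern x x) (at x)"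
proof -
  have "((\<lambda>t. \<i> / (2 * pi) * (T x * cnj ((T t - T x) / of_real (t - x)))) \<longlongrightarrow>
     \<i> / (2 * pi) * (T x * cnj (deriv T x))) (at x)"
    by (intro tendsto_intros difference_quotient_tendsto)
  moreover have "\<i> / (2 * pi) * (T x * cnj (deriv T x)) = kern x x"
    by (simp add: kern_def)
  moreover have "eventually (\<lambda>t. \<i> / (2 * pi) * (T x * cnj ((T t - T x) / of_real (t - x))) = kern x t) (at x)"
    unfolding eventually_at_filter by (intro always_eventually allI impI kern_offdiag[symmetric]) auto
  ultimately show ?thesis
    using Lim_transform_eventually by force
qed

text \<open>\<open>T\<close> moves on the unit circle, so its velocity is orthogonal to its
  position. In the proof: \<open>Re (T x * cnj (T t))\<close> is at most 1, its value at
  \<open>t = x\<close>, so the difference quotients from the right and from the left have opposite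
  signs.\<close>

lemma Re_T_cnj_deriv:
  fixes x :: real
  shows "Re (T x * cnj (deriv T x)) = 0"
proof -
  let ?h = "\<lambda>t::real. Re (T (of_real x) * cnj ((T (of_real t) - T (of_real x)) / of_real (t - x)))"
  have eq: "?h t = (Re (T x * cnj (T t)) - 1) / (t - x)" for t
  proof -
    have "T (of_real x) * cnj ((T (of_real t) - T (of_real x)) / of_real (t - x)) = (T x * cnj (T t) - 1) / of_real (t - x)"
      by (simp add: right_diff_distrib)
    then show ?thesis
      by (simp only: Re_divide_of_real) simp
  qed
  have le: "Re (T x * cnj (T t)) - 1 \<le> 0" for t :: real
    using complex_Re_le_cmod[of "T x * cnj (T t)"] by (simp add: norm_mult)
  have lim: "(?h \<longlongrightarrow> Re (T x * cnj (deriv T x))) (at x)"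
    by (intro tendsto_intros difference_quotient_tendsto)
  have "(?h \<longlongrightarrow> Re (T x * cnj (deriv T x))) (at_right x)" "(?h \<longlongrightarrow> Re (T x * cnj (deriv T x))) (at_left x)"
    using lim by (auto simp: filterlim_at_split)
  moreover have "eventually (\<lambda>t. ?h t \<le> 0) (at_right x)"
    unfolding eq eventually_at_filter
    by (intro always_eventually allI impI divide_nonpos_pos le) auto
  moreover have "eventually (\<lambda>t. 0 \<le> ?h t) (at_left x)"
    unfolding eq eventually_at_filter
    by (intro always_eventually allI impI divide_nonpos_neg le) auto
  ultimately have "Re (T x * cnj (deriv T x)) \<le> 0" "0 \<le> Re (T x * cnj (deriv T x))"
    using tendsto_upperbound[of ?h _ "at_right x" 0] tendsto_lowerbound[of ?h _ "at_left x" 0] by auto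
  then show ?thesis
    by simp
qed

lemma kern_hermitian: "kern y x = cnj (kern x y)"
proof (cases "x = y")
  case True
  have "Im (kern x x) = 0"
    using Re_T_cnj_deriv[of x] by (simp add: kern_def)
  then show ?thesis
    using True by (simp add: complex_eq_iff)
next
  case False
  then have "complex_of_real x \<noteq> complex_of_real y"
    by simp
  then have "kern y x = (1 - T y * cnj (T x)) / (2 * pi * \<i> * (x - y))"
    using False unfolding kern_def by (auto simp: divide_simps) (simp add: algebra_simps)
  also have "\<dots> = cnj (kern x y)"
    using False by (simp add: kern_def mult.commute)
  finally show ?thesis .
qed

text \<open>The numerator has modulus at most 2, which gives even \<open>1 / (pi * |x - y|)\<close>;
  the factor \<open>1 / pi\<close> is given away.\<close>

lemma kern_bound:
  assumes "x \<noteq> y"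
  shows "cmod (kern x y) \<le> 1 / \<bar>x - y\<bar>"
proof -
  have "cmod (1 - T x * cnj (T y)) \<le> 2"
    using norm_triangle_ineq4[of 1 "T x * cnj (T y)"] by (simp add: norm_mult)
  then have "cmod (1 - T x * cnj (T y)) / (2 * pi * \<bar>x - y\<bar>) \<le> 2 / (2 * pi * \<bar>x - y\<bar>)"
    by (intro divide_right_mono) auto
  moreover have "cmod (kern x y) = cmod (1 - T x * cnj (T y)) / (2 * pi * \<bar>x - y\<bar>)"
    using assms unfolding kern_def by (simp add: norm_divide norm_mult flip: of_real_diff)
  ultimately have "cmod (kern x y) \<le> 2 / (2 * pi * \<bar>x - y\<bar>)"
    by simp
  also have "\<dots> \<le> 1 / \<bar>x - y\<bar>"
    using assms pi_gt3 by (simp add: divide_simps)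
  finally show ?thesis .
qed

text \<open>Since the kernel is a difference quotient of \<open>T\<close> up to a factor of modulus
  below 1, the mean value inequality along the real segment bounds it by the maximum of
  \<open>|T'|\<close> there, near the diagonal as well.\<close>

lemma kern_locally_bounded: "\<exists>M. \<forall>x y. \<bar>x\<bar> \<le> R \<longrightarrow> \<bar>y\<bar> \<le> R \<longrightarrow> cmod (kern x y) \<le> M"
proof -
  have "compact ((\<lambda>x. deriv T (complex_of_real x)) ` {-R..R})"
    by (intro compact_continuous_image continuous_deriv_T) auto
  then obtain L where L: "\<And>x. x \<in> {-R..R} \<Longrightarrow> cmod (deriv T (complex_of_real x)) \<le> L"
    using compact_imp_bounded bounded_iff by (metis imageI)
  have "cmod (kern x y) \<le> L" if "\<bar>x\<bar> \<le> R" "\<bar>y\<bar> \<le> R" for x y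
  proof -
    have xy: "x \<in> {-R..R}" "y \<in> {-R..R}"
      using that by auto
    have *: "cmod (\<i> / (2 * pi) * (T x * z)) \<le> cmod z" for z
      using pi_gt3 by (simp add: norm_mult norm_divide divide_simps mult_le_cancel_left1)
    show ?thesis
    proof (cases "x = y")
      case True
      have "kern x x = \<i> / (2 * pi) * (T x * cnj (deriv T x))"
        by (simp add: kern_def)
      then have "cmod (kern x x) \<le> cmod (cnj (deriv T x))"
        by (simp only: *)
      then show ?thesis
        using L[OF xy(1)] True by simp
    next
      case False
      have "cmod (T y - T x) \<le> L * cmod (complex_of_real y - complex_of_real x)"
      proof (rule field_differentiable_bound[of "of_real ` {-R..R}" T "deriv T"])
        show "convex (complex_of_real ` {-R..R})"
          by (intro convex_linear_image) (auto simp: linear_iff scaleR_conv_of_real)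
      qed (use xy L in \<open>auto intro: has_field_derivative_at_within[OF DERIV_T]\<close>)
      then have "cmod ((T y - T x) / of_real (y - x)) \<le> L"
        using False by (simp add: norm_divide divide_simps mult.commute flip: of_real_diff)
      moreover have "cmod (kern x y) \<le> cmod (cnj ((T y - T x) / of_real (y - x)))"
        unfolding kern_offdiag[OF False] by (rule *)
      ultimately show ?thesis
        by (metis complex_mod_cnj order_trans)
    qed
  qed
  then show ?thesis
    by blast
qed

lemma kern_measurable: "(\<lambda>z. kern (fst z) (snd z)) \<in> borel_measurable (borel \<Otimes>\<^sub>M borel)"
proof -
  have [measurable]: "(\<lambda>x. T (complex_of_real x)) \<in> borel_measurable borel"
    "(\<lambda>x. deriv T (complex_of_real x)) \<in> borel_measurable borel"
    using continuous_T continuous_deriv_T by (auto intro: borel_measurable_continuous_onI)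
  have [measurable]: "cnj \<in> borel_measurable borel"
    by (intro borel_measurable_continuous_onI continuous_intros)
  show ?thesis
    unfolding kern_def by measurable
qed

end

section \<open>The reproducing identity on the diagonal by contour integration\<close>

context inner_function
begin

text \<open>With \<open>u = T * cnj (T x)\<close> the function \<open>(u - 1) / (z - x)^2\<close>
  has at most a simple pole with residue \<open>q = u'(x)\<close>, sitting on the contour.
  Subtracting \<open>q / (z - x)\<close> removes it. Since \<open>q\<close> is purely imaginary, the
  subtracted term has no real part on the real axis, while over the arc it integrates to
  \<open>q * \<i> * pi = - pi * Im q\<close>, the main term.\<close>

lemma half_disc_integral:
  fixes x r :: real
  assumes r: "0 < r"
  obtains J where "((\<lambda>y. (1 - Re (T y * cnj (T x))) / (y - x)\<^sup>2) has_integral J) {x - r..x + r}"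
    "\<bar>J - pi * Im (deriv T x * cnj (T x))\<bar> \<le> 2 * pi / r"
proof -
  obtain U where U: "open U" "{z. 0 \<le> Im z} \<subseteq> U" "T holomorphic_on U"
    using analytic by (auto simp: analytic_on_holomorphic)
  define u where "u z = T z * cnj (T x)" for z
  define q where "q = deriv T x * cnj (T x)"
  have Re_q: "Re q = 0"
    using Re_T_cnj_deriv[of x] by (simp add: q_def mult.commute)
  have u_x: "u x = 1"
    by (simp add: u_def)
  have deriv_u: "deriv u x = q"
    unfolding u_def q_def by (intro DERIV_imp_deriv DERIV_cmult_right DERIV_T)
  \<comment> \<open>Filling in the derivative keeps each successive difference quotient holomorphic,
    so that Cauchy's theorem applies although \<open>x\<close> lies on the boundary of the half
    disc.\<close>
  define h1 where "h1 z = (if z = of_real x then deriv u x else (u z - u x) / (z - x))" for z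
  define h2 where "h2 z = (if z = of_real x then deriv h1 x else (h1 z - h1 x) / (z - x))" for z
  have "u holomorphic_on U"
    unfolding u_def by (intro holomorphic_intros U)
  then have "h1 holomorphic_on U"
    unfolding h1_def using U(1) by (rule pole_lemma_open)
  then have hol: "h2 holomorphic_on U"
    unfolding h2_def using U(1) by (rule pole_lemma_open)
  have h2_eq: "h2 z = (u z - 1) / (z - x)\<^sup>2 - q / (z - x)" if "z \<noteq> of_real x" for z
    using that by (simp add: h2_def h1_def u_x deriv_u power2_eq_square diff_divide_distrib)
  let ?arc = "part_circlepath (of_real x) r 0 pi" and ?line = "linepath (complex_of_real (x - r)) (complex_of_real (x + r))"
  let ?S = "cball (complex_of_real x) r \<inter> {z. 0 \<le> Im z}"
  have S: "convex ?S" "?S \<subseteq> U"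
    using U(2) by (auto intro!: convex_Int convex_halfspace_Im_ge[of 0])
  have arc: "path_image ?arc \<subseteq> ?S"
  proof -
    have "path_image ?arc \<subseteq> sphere (of_real x) r"
      using r by (intro path_image_part_circlepath_subset') auto
    moreover have "0 \<le> Im z" if "z \<in> path_image ?arc" for z
      using that r unfolding path_image_part_circlepath'
      by (auto simp: closed_segment_eq_real_ivl sin_ge_zero)
    ultimately show ?thesis
      by auto
  qed
  have line: "path_image ?line \<subseteq> ?S"
    unfolding path_image_linepath using r
    by (intro closed_segment_subset S(1)) (auto simp: dist_norm)
  have cont: "continuous_on A h2" if "A \<subseteq> ?S" for A
    using that S(2) hol by (intro continuous_on_subset[OF holomorphic_on_imp_continuous_on[OF hol]]) auto
  have "(h2 has_contour_integral 0) (?arc +++ ?line)"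
  proof (rule Cauchy_theorem_convex_simple[OF _ S(1)])
    show "h2 holomorphic_on ?S"
      using hol S(2) by (rule holomorphic_on_subset)
    show "path_image (?arc +++ ?line) \<subseteq> ?S"
      using arc line by (intro subset_path_image_join)
  qed (auto intro!: valid_path_join simp: exp_Euler mult.commute[of \<i>])
  moreover have int_arc: "(h2 has_contour_integral contour_integral ?arc h2) ?arc"
    by (intro has_contour_integral_integral contour_integrable_continuous_part_circlepath cont arc)
  moreover have int_line: "(h2 has_contour_integral contour_integral ?line h2) ?line"
    by (intro has_contour_integral_integral contour_integrable_continuous_linepath cont)
       (use line in simp)
  ultimately have sum0: "contour_integral ?arc h2 + contour_integral ?line h2 = 0"
    using has_contour_integral_join[OF int_arc int_line] has_contour_integral_unique by fastforce
  define A where "A = contour_integral ?arc h2"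
  have "((\<lambda>z. 1 / (z - x)) has_contour_integral (\<i> * pi)) ?arc"
  proof (subst has_contour_integral_part_circlepath_iff)
    have "((\<lambda>t::real. \<i>) has_integral (pi - 0) *\<^sub>R \<i>) {0..pi}"
      using has_integral_const_real[of \<i> 0 pi] by simp
    moreover have "(\<lambda>t. 1 / (complex_of_real x + r * cis t - x) * r * \<i> * cis t) = (\<lambda>t. \<i>)"
      using r by auto
    ultimately show "((\<lambda>t. 1 / (complex_of_real x + r * cis t - x) * r * \<i> * cis t) has_integral \<i> * pi) {0..pi}"
      by (simp only:) (simp add: scaleR_conv_of_real mult.commute)
  qed simp
  then have "((\<lambda>z. q * (1 / (z - x))) has_contour_integral q * (\<i> * pi)) ?arc"
    by (rule has_contour_integral_lmul)
  \<comment> \<open>On the arc \<open>h2\<close> alone has in general only order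
    \<open>1 / r\<close>, too large for an arc of length \<open>pi * r\<close>. Adding
    \<open>q / (z - x)\<close> back leaves \<open>(u - 1) / (z - x)^2\<close>, of modulus at most
    \<open>2 / r^2\<close>.\<close>
  with int_arc have "((\<lambda>z. h2 z + q * (1 / (z - x))) has_contour_integral A + q * (\<i> * pi)) ?arc"
    unfolding A_def by (rule has_contour_integral_add)
  then have "cmod (A + q * (\<i> * pi)) \<le> (2 / r\<^sup>2) * r * (pi - 0)"
  proof (rule has_contour_integral_bound_part_circlepath)
    fix z assume z: "z \<in> path_image ?arc"
    then have norm_z: "cmod (z - x) = r"
      using r by (intro in_path_image_part_circlepath) auto
    then have "z \<noteq> of_real x"
      using r by auto
    then have "h2 z + q * (1 / (z - x)) = (u z - 1) / (z - x)\<^sup>2"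
      by (simp add: h2_eq)
    moreover have "cmod (u z - 1) \<le> 2"
      using norm_triangle_ineq4[of "u z" 1] bound[of z] z arc by (auto simp: u_def norm_mult)
    ultimately show "cmod (h2 z + q * (1 / (z - x))) \<le> 2 / r\<^sup>2"
      using norm_z r by (simp add: norm_divide norm_power divide_right_mono)
  qed (use r in auto)
  then have bnd: "cmod (A + q * (\<i> * pi)) \<le> 2 * pi / r"
    using r by (simp add: power2_eq_square)
  have "((\<lambda>y. h2 (of_real y)) has_integral (- A)) {x - r..x + r}"
    using int_line sum0 r unfolding A_def
    by (subst (asm) has_contour_integral_linepath_Reals_iff) (auto simp: add_eq_0_iff)
  from has_integral_neg[OF has_integral_linear[OF this bounded_linear_Re]]
  have "((\<lambda>y. - Re (h2 (of_real y))) has_integral - Re (- A)) {x - r..x + r}"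
    by (simp only: o_def)
  then have "((\<lambda>y. (1 - Re (T y * cnj (T x))) / (y - x)\<^sup>2) has_integral - Re (- A)) {x - r..x + r}"
  proof (rule has_integral_spike_finite[of "{x}", rotated 2])
    fix y assume "y \<in> {x - r..x + r} - {x}"
    then have y: "complex_of_real y \<noteq> of_real x"
      by auto
    have "h2 y = (u y - 1) / of_real ((y - x)\<^sup>2) - q / of_real (y - x)"
      using h2_eq[OF y] by simp
    then have "Re (h2 y) = (Re (u y) - 1) / (y - x)\<^sup>2"
      using Re_q by (simp only: Re_divide_of_real minus_complex.simps) simp
    then show "(1 - Re (T y * cnj (T x))) / (y - x)\<^sup>2 = - Re (h2 y)"
      by (simp only: u_def) (simp add: diff_divide_distrib)
  qed simp
  moreover have "\<bar>- Re (- A) - pi * Im q\<bar> \<le> 2 * pi / r"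
    using order_trans[OF abs_Re_le_cmod bnd] by (simp add: mult.commute)
  ultimately show ?thesis
    using that[of "- Re (- A)"] by (simp add: q_def)
qed

lemma kern_diag: "kern x x = of_real (Im (deriv T x * cnj (T x)) / (2 * pi))"
  using Re_T_cnj_deriv[of x]
  by (simp add: kern_def complex_eq_iff mult.commute)

text \<open>For unimodular \<open>w\<close> one has \<open>|1 - w|^2 = 2 * (1 - Re w)\<close>, so
  \<open>|kern x y|^2\<close> is \<open>1 / (2 pi^2)\<close> times the integrand of
  \<open>half_disc_integral\<close>. Radii \<open>n + 1\<close> exhaust the line and the error
  \<open>2 pi / (n + 1)\<close> vanishes. Nonnegativity of the diagonal follows because it is a
  positive multiple of a limit of integrals of a nonnegative function.\<close>

lemma
  fixes x :: real
  shows kern_diag_nonneg: "0 \<le> Re (kern x x)"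
    and kern_reproducing: "(\<integral>\<^sup>+y. ennreal ((cmod (kern x y))\<^sup>2) \<partial>lborel) = ennreal (Re (kern x x))"
proof -
  define f where "f y = (1 - Re (T y * cnj (T x))) / (y - x)\<^sup>2" for y :: real
  define p where "p = pi * Im (deriv T x * cnj (T x))"
  have f_nonneg: "0 \<le> f y" for y
    using complex_Re_le_cmod[of "T y * cnj (T x)"] unfolding f_def
    by (intro divide_nonneg_nonneg) (auto simp: norm_mult)
  have [measurable]: "(\<lambda>x. T (complex_of_real x)) \<in> borel_measurable borel"
    using continuous_T by (auto intro: borel_measurable_continuous_onI)
  have [measurable]: "f \<in> borel_measurable borel"
    unfolding f_def by measurable
  have "\<exists>J. (f has_integral J) {x - real (Suc n)..x + real (Suc n)} \<and> \<bar>J - p\<bar> \<le> 2 * pi / real (Suc n)" for n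
    by (rule half_disc_integral[of "real (Suc n)" x]) (auto simp: f_def[abs_def] p_def)
  then obtain J where J: "\<And>n. (f has_integral J n) {x - real (Suc n)..x + real (Suc n)}"
    "\<And>n. \<bar>J n - p\<bar> \<le> 2 * pi / real (Suc n)"
    by metis
  have J_diff: "norm (J n - p) \<le> 2 * pi * inverse (real (Suc n))" for n
    using J(2)[of n] by (simp only: real_norm_def divide_inverse)
  have "(\<lambda>n. 2 * pi * inverse (real (Suc n))) \<longlonglongrightarrow> 2 * pi * 0"
    by (intro tendsto_intros LIMSEQ_inverse_real_of_nat)
  then have "(\<lambda>n. J n - p) \<longlonglongrightarrow> 0"
    by (intro Lim_null_comparison[OF always_eventually[OF allI[OF J_diff]]]) simp
  then have J_lim: "J \<longlonglongrightarrow> p"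
    by (simp add: LIM_zero_iff)
  have "0 \<le> J n" for n
    using has_integral_nonneg[OF J(1)] f_nonneg by auto
  with J_lim have p: "0 \<le> p"
    by (intro LIMSEQ_le_const) auto
  let ?g = "\<lambda>n y. ennreal (f y) * indicator {x - real (Suc n)..x + real (Suc n)} y"
  have "(\<lambda>n. \<integral>\<^sup>+y. ?g n y \<partial>lborel) \<longlonglongrightarrow> (\<integral>\<^sup>+y. ennreal (f y) \<partial>lborel)"
  proof (rule nn_integral_LIMSEQ)
    show "incseq ?g"
      by (intro incseq_SucI le_funI mult_left_mono) (auto simp: indicator_def)
    show "(\<lambda>n. ?g n y) \<longlonglongrightarrow> ennreal (f y)" for y
    proof (rule tendsto_eventually)
      show "eventually (\<lambda>n. ?g n y = ennreal (f y)) sequentially"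
      proof (rule eventually_sequentiallyI[of "nat \<lceil>\<bar>y - x\<bar>\<rceil>"])
        fix n assume "nat \<lceil>\<bar>y - x\<bar>\<rceil> \<le> n"
        then have "y \<in> {x - real (Suc n)..x + real (Suc n)}"
          unfolding atLeastAtMost_iff by linarith
        then show "?g n y = ennreal (f y)"
          by simp
      qed
    qed
  qed measurable
  moreover have "(\<integral>\<^sup>+y. ?g n y \<partial>lborel) = ennreal (J n)" for n
    using nn_integral_has_integral_lebesgue'[OF f_nonneg J(1)] .
  ultimately have "(\<lambda>n. ennreal (J n)) \<longlonglongrightarrow> (\<integral>\<^sup>+y. ennreal (f y) \<partial>lborel)"
    by simp
  moreover have "(\<lambda>n. ennreal (J n)) \<longlonglongrightarrow> ennreal p"
    using J_lim by (rule tendsto_ennrealI)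
  ultimately have total: "(\<integral>\<^sup>+y. ennreal (f y) \<partial>lborel) = ennreal p"
    using LIMSEQ_unique by blast
  have sq: "(cmod (kern x y))\<^sup>2 = (1 / (2 * pi\<^sup>2)) * f y" if "x \<noteq> y" for y
  proof -
    have eq: "(cmod (1 - T x * cnj (T y)))\<^sup>2 = 2 * (1 - Re (T y * cnj (T x)))"
    proof -
      have "(cmod (1 - w))\<^sup>2 = 1 + (cmod w)\<^sup>2 - 2 * Re w" for w
        unfolding cmod_power2 by (simp add: power2_eq_square algebra_simps)
      moreover have "cmod (T x * cnj (T y)) = 1"
        by (simp add: norm_mult)
      moreover have "Re (T x * cnj (T y)) = Re (T y * cnj (T x))"
        by (simp add: mult.commute)
      ultimately show ?thesis
        by (simp only:) simp
    qed
    have scale: "2 * a / (2 * pi * \<bar>x - y\<bar>)\<^sup>2 = (1 / (2 * pi\<^sup>2)) * (a / (y - x)\<^sup>2)" for a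
      by (simp add: power_mult_distrib power2_commute[of x y])
    have "(cmod (kern x y))\<^sup>2 = (cmod (1 - T x * cnj (T y)))\<^sup>2 / (2 * pi * \<bar>x - y\<bar>)\<^sup>2"
      using that unfolding kern_def by (simp add: norm_divide norm_mult power_divide flip: of_real_diff)
    moreover have "(cmod (1 - T x * cnj (T y)))\<^sup>2 / (2 * pi * \<bar>x - y\<bar>)\<^sup>2 = (1 / (2 * pi\<^sup>2)) * f y"
      unfolding eq f_def by (rule scale)
    ultimately show ?thesis
      by simp
  qed
  have "(\<integral>\<^sup>+y. ennreal ((cmod (kern x y))\<^sup>2) \<partial>lborel) = (\<integral>\<^sup>+y. ennreal (1 / (2 * pi\<^sup>2)) * ennreal (f y) \<partial>lborel)"
  proof (rule nn_integral_cong_AE)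
    \<comment> \<open>At \<open>y = x\<close> the function \<open>f\<close> is 0 by division by
      zero, whatever the kernel is there; this single point is discarded.\<close>
    show "AE y in lborel. ennreal ((cmod (kern x y))\<^sup>2) = ennreal (1 / (2 * pi\<^sup>2)) * ennreal (f y)"
      using AE_lborel_singleton[of x] by eventually_elim (simp add: sq ennreal_mult'[symmetric])
  qed
  also have "\<dots> = ennreal (1 / (2 * pi\<^sup>2)) * ennreal p"
    by (subst nn_integral_cmult) (auto simp: total)
  also have "\<dots> = ennreal (Re (kern x x))"
    unfolding kern_diag p_def by (subst ennreal_mult'[symmetric]) (auto simp: power2_eq_square)
  finally show "(\<integral>\<^sup>+y. ennreal ((cmod (kern x y))\<^sup>2) \<partial>lborel) = ennreal (Re (kern x x))" .
  show "0 \<le> Re (kern x x)"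
  proof -
    have "0 \<le> Im (deriv T x * cnj (T x))"
      using p pi_gt_zero unfolding p_def by (simp only: zero_le_mult_iff) linarith
    then show ?thesis
      unfolding kern_diag Re_complex_of_real by (intro divide_nonneg_nonneg) auto
  qed
qed

text \<open>At real zeros of \<open>E\<close> the kernel is 0 because of division by zero.\<close>
lemma db_kernel_eq:
  assumes E: "de_branges_function E" and T: "\<And>x::real. E x \<noteq> 0 \<Longrightarrow> T x = sharp E x / E x"
  shows "db_kernel E x y = (if E x = 0 \<or> E y = 0 then 0 else kern x y)"
proof -
  have off: "db_kernel0 E s t = kern s t" if "s \<noteq> t" "E s \<noteq> 0" "E t \<noteq> 0" for s t :: real
  proof -
    have "db_kernel0 E s t = (E s * cnj (E t) - sharp E s * cnj (sharp E t)) / (E s * cnj (E t))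
        / (- 2 * pi * \<i> * (s - t))"
      unfolding db_kernel0_def by (simp add: mult_ac)
    also have "(E s * cnj (E t) - sharp E s * cnj (sharp E t)) / (E s * cnj (E t)) = 1 - T s * cnj (T t)"
      using that by (simp add: T diff_divide_distrib)
    finally show ?thesis
      using that by (simp add: kern_def)
  qed
  have zero: "db_kernel0 E s t = 0" if "E s = 0 \<or> E t = 0" for s t :: real
    using that by (auto simp: db_kernel0_def)
  consider "x \<noteq> y" | "x = y" "E x = 0" | "x = y" "E x \<noteq> 0"
    by auto
  then show ?thesis
  proof cases
    case 1
    then show ?thesis
      using off zero by (simp add: db_kernel_def)
  next
    case 2
    have "((\<lambda>t. db_kernel0 E x t) \<longlongrightarrow> 0) (at x)"
      using 2 by (simp add: zero)
    then have "Lim (at x) (\<lambda>t. db_kernel0 E x t) = 0"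
      by (intro tendsto_Lim) auto
    with 2 show ?thesis
      by (simp add: db_kernel_def)
  next
    case 3
    have "eventually (\<lambda>t. E (complex_of_real t) \<noteq> 0) (at x)"
      using eventually_compose_filterlim[OF de_branges_zeros_isolated[OF E] filterlim_of_real_at_complex] .
    then have "eventually (\<lambda>t. kern x t = db_kernel0 E x t) (at x)"
      unfolding eventually_at_filter by eventually_elim (use 3 off in auto)
    then have "((\<lambda>t. db_kernel0 E x t) \<longlongrightarrow> kern x x) (at x)"
      by (rule Lim_transform_eventually[OF kern_tendsto])
    then have "Lim (at x) (\<lambda>t. db_kernel0 E x t) = kern x x"
      by (intro tendsto_Lim) auto
    with 3 show ?thesis
      by (simp add: db_kernel_def)
  qed
qed

end

section \<open>Moments of linear statistics\<close>

lemma space_conf_sigma [simp]: "space (conf_sigma C) = Conf"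
  and sets_conf_sigma: "sets (conf_sigma C) = sigma_sets Conf (conf_generators C)"
proof -
  have "conf_generators C \<subseteq> Pow Conf"
    by (auto simp: conf_generators_def)
  then show "space (conf_sigma C) = Conf" "sets (conf_sigma C) = sigma_sets Conf (conf_generators C)"
    by (simp_all add: conf_sigma_def)
qed

lemma measurable_cnt:
  assumes "B \<in> sets borel" "bounded B" "B \<subseteq> C"
  shows "cnt B \<in> measurable (conf_sigma C) (count_space UNIV)"
proof (subst measurable_count_space_eq2_countable, intro conjI ballI)
  fix k
  have "cnt B -` {k} \<inter> Conf \<in> conf_generators C"
    using assms unfolding conf_generators_def by blast
  then show "cnt B -` {k} \<inter> space (conf_sigma C) \<in> sets (conf_sigma C)"
    by (simp add: sets_conf_sigma sigma_sets.Basic)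
qed auto

text \<open>The window \<open>D\<close> keeps the sum finite and records which part of the
  configuration is read: the same \<open>f\<close> is used below with a window containing
  \<open>B\<close> and with that window minus \<open>B\<close>.\<close>

definition linear_statistic :: "real set \<Rightarrow> (real \<Rightarrow> real) \<Rightarrow> real set \<Rightarrow> real" where
  "linear_statistic D f X = (\<Sum>x\<in>X \<inter> D. f x)"

lemma finite_Conf: "X \<in> Conf \<Longrightarrow> bounded D \<Longrightarrow> finite (X \<inter> D)"
  by (auto simp: Conf_def)

text \<open>For indicators the statistic is a count in a subset of the window, hence of
  \<open>C\<close>; general nonnegative functions follow by monotone approximation.\<close>

lemma measurable_linear_statistic:
  assumes D: "D \<in> sets borel" "bounded D" "D \<subseteq> C"
    and f: "f \<in> borel_measurable borel" "\<And>x. 0 \<le> f x"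
  shows "linear_statistic D f \<in> borel_measurable (conf_sigma C)"
  using f
proof (induction f rule: borel_measurable_induct_real)
  case (set A)
  have eq: "linear_statistic D (indicator A) X = real (cnt (D \<inter> A) X)" if "X \<in> Conf" for X
    using finite_Conf[OF that D(2)]
    by (simp add: linear_statistic_def cnt_def sum.If_cases indicator_def Int_assoc)
  have "cnt (D \<inter> A) \<in> measurable (conf_sigma C) (count_space UNIV)"
    using D set by (intro measurable_cnt) (auto intro: bounded_subset)
  then have "(\<lambda>X. real (cnt (D \<inter> A) X)) \<in> borel_measurable (conf_sigma C)"
    by measurable
  then show ?case
    by (subst measurable_cong[OF eq]) auto
next
  case (mult u c)
  have "linear_statistic D (\<lambda>x. c * u x) = (\<lambda>X. c * linear_statistic D u X)"
    by (simp add: linear_statistic_def sum_distrib_left fun_eq_iff)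
  with mult show ?case
    by simp
next
  case (add u v)
  have "linear_statistic D (\<lambda>x. v x + u x) = (\<lambda>X. linear_statistic D v X + linear_statistic D u X)"
    by (simp add: linear_statistic_def sum.distrib fun_eq_iff)
  with add show ?case
    by simp
next
  case (seq U)
  show ?case
  proof (rule borel_measurable_LIMSEQ_real)
    show "(\<lambda>i. linear_statistic D (U i) X) \<longlonglongrightarrow> linear_statistic D f X" for X
      unfolding linear_statistic_def using seq by (intro tendsto_sum) auto
  qed (use seq in auto)
qed


section \<open>Second-order expansion of products and of power series at 0\<close>

lemma prod_one_minus_ge:
  fixes f :: "'a \<Rightarrow> real"
  assumes "finite F" "\<And>x. x \<in> F \<Longrightarrow> 0 \<le> f x \<and> f x \<le> 1"
  shows "1 - (\<Sum>x\<in>F. f x) \<le> (\<Prod>x\<in>F. 1 - f x)"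
  using assms
proof (induction F rule: finite_induct)
  case (insert a F)
  let ?p = "\<Prod>x\<in>F. 1 - f x"
  have "0 \<le> ?p" "?p \<le> 1"
    using insert.prems by (auto intro!: prod_nonneg prod_le_1)
  then have "f a * ?p \<le> f a"
    using insert.prems by (intro mult_left_le) auto
  then show ?case
    using insert by (simp add: algebra_simps)
qed simp

text \<open>The product is the generating polynomial of the elementary symmetric functions of the
  values \<open>f x\<close>, with alternating signs. The second limit is the sum over unordered
  pairs, written through power sums.\<close>

lemma prod_one_minus_expansion:
  fixes f :: "'a \<Rightarrow> real"
  assumes "finite F"
  shows "((\<lambda>s. (1 - (\<Prod>x\<in>F. 1 - s * f x)) / s) \<longlongrightarrow> (\<Sum>x\<in>F. f x)) (at 0)"
    and "((\<lambda>s. ((\<Prod>x\<in>F. 1 - s * f x) - 1 + s * (\<Sum>x\<in>F. f x)) / s\<^sup>2)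
           \<longlongrightarrow> ((\<Sum>x\<in>F. f x)\<^sup>2 - (\<Sum>x\<in>F. (f x)\<^sup>2)) / 2) (at 0)"
  using assms
proof (induction F rule: finite_induct)
  case empty
  show "((\<lambda>s. (1 - (\<Prod>x\<in>{}. 1 - s * f x)) / s) \<longlongrightarrow> (\<Sum>x\<in>{}. f x)) (at 0)"
    "((\<lambda>s. ((\<Prod>x\<in>{}. 1 - s * f x) - 1 + s * (\<Sum>x\<in>{}. f x)) / s\<^sup>2)
           \<longlongrightarrow> ((\<Sum>x\<in>{}. f x)\<^sup>2 - (\<Sum>x\<in>{}. (f x)\<^sup>2)) / 2) (at 0)"
    by simp_all
next
  case (insert a F)
  let ?p = "\<lambda>s. \<Prod>x\<in>F. 1 - s * f x" and ?S = "\<Sum>x\<in>F. f x" and ?Q = "\<Sum>x\<in>F. (f x)\<^sup>2"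
  have "(?p \<longlongrightarrow> (\<Prod>x\<in>F. 1 - 0 * f x)) (at 0)"
    by (intro tendsto_intros)
  then have p1: "(?p \<longlongrightarrow> 1) (at 0)"
    by simp
  have "((\<lambda>s. (1 - ?p s) / s + f a * ?p s) \<longlongrightarrow> ?S + f a * 1) (at 0)"
    by (intro tendsto_intros insert.IH p1)
  moreover have "eventually (\<lambda>s. (1 - ?p s) / s + f a * ?p s = (1 - (\<Prod>x\<in>insert a F. 1 - s * f x)) / s) (at 0)"
    unfolding eventually_at_filter using insert.hyps
    by (intro always_eventually allI impI) (simp add: field_simps)
  ultimately show "((\<lambda>s. (1 - (\<Prod>x\<in>insert a F. 1 - s * f x)) / s) \<longlongrightarrow> (\<Sum>x\<in>insert a F. f x)) (at 0)"
    using insert.hyps by (auto simp: add.commute intro: Lim_transform_eventually)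
  have lim: "((\<lambda>s. (?p s - 1 + s * ?S) / s\<^sup>2 + f a * ((1 - ?p s) / s)) \<longlongrightarrow> (?S\<^sup>2 - ?Q) / 2 + f a * ?S) (at 0)"
    by (intro tendsto_intros insert.IH)
  have ev: "eventually (\<lambda>s. (?p s - 1 + s * ?S) / s\<^sup>2 + f a * ((1 - ?p s) / s) =
      ((\<Prod>x\<in>insert a F. 1 - s * f x) - 1 + s * (\<Sum>x\<in>insert a F. f x)) / s\<^sup>2) (at 0)"
    unfolding eventually_at_filter using insert.hyps
    by (intro always_eventually allI impI) (simp add: field_simps power2_eq_square)
  have eq: "(?S\<^sup>2 - ?Q) / 2 + f a * ?S = ((\<Sum>x\<in>insert a F. f x)\<^sup>2 - (\<Sum>x\<in>insert a F. (f x)\<^sup>2)) / 2"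
    using insert.hyps by (simp add: power2_sum field_simps)
  from Lim_transform_eventually[OF lim ev] show "((\<lambda>s. ((\<Prod>x\<in>insert a F. 1 - s * f x) - 1 + s * (\<Sum>x\<in>insert a F. f x)) / s\<^sup>2)
           \<longlongrightarrow> ((\<Sum>x\<in>insert a F. f x)\<^sup>2 - (\<Sum>x\<in>insert a F. (f x)\<^sup>2)) / 2) (at 0)"
    unfolding eq .
qed

text \<open>Removing the initial terms and dividing leaves a convergent power series, whose limit at
  0 is its constant coefficient.\<close>

lemma powser_taylor_limits:
  fixes c :: "nat \<Rightarrow> complex"
  assumes "\<And>z. (\<lambda>n. c n * z ^ n) sums G z"
  shows "((\<lambda>z. (G z - c 0) / z) \<longlongrightarrow> c 1) (at 0)"
    and "((\<lambda>z. (G z - c 0 - c 1 * z) / z\<^sup>2) \<longlongrightarrow> c 2) (at 0)"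
proof -
  have "(\<lambda>n. c (n + 1) * z ^ n) sums ((G z - c 0) / z)" if "z \<noteq> 0" for z
  proof -
    have "(\<lambda>n. c (n + 1) * z ^ (n + 1)) sums (G z - (\<Sum>i<1. c i * z ^ i))"
      using assms[of z] by (rule sums_split_initial_segment)
    from sums_divide[OF this, of z] show ?thesis
      using that by (simp add: field_simps)
  qed
  from powser_limit_0_strong[of 1, OF _ this]
  show "((\<lambda>z. (G z - c 0) / z) \<longlongrightarrow> c 1) (at 0)"
    by simp
  have "(\<lambda>n. c (n + 2) * z ^ n) sums ((G z - c 0 - c 1 * z) / z\<^sup>2)" if "z \<noteq> 0" for z
  proof -
    have "(\<lambda>n. c (n + 2) * z ^ (n + 2)) sums (G z - (\<Sum>i<2. c i * z ^ i))"
      using assms[of z] by (rule sums_split_initial_segment)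
    from sums_divide[OF this, of "z\<^sup>2"] show ?thesis
      using that by (simp add: numeral_2_eq_2 field_simps)
  qed
  from powser_limit_0_strong[of 1, OF _ this]
  show "((\<lambda>z. (G z - c 0 - c 1 * z) / z\<^sup>2) \<longlongrightarrow> c 2) (at 0)"
    by (simp add: numeral_2_eq_2)
qed

lemma leibniz_det_scale: "leibniz_det n (\<lambda>i j. a * M i j) = a ^ n * leibniz_det n M"
  unfolding leibniz_det_def by (simp add: prod.distrib sum_distrib_left mult_ac)

text \<open>Each of the \<open>n\<close> rows carries one factor \<open>g - 1\<close>, so the
  \<open>n\<close>-th term is homogeneous of degree \<open>n\<close> and the Fredholm series becomes
  a power series in \<open>z\<close>.\<close>

lemma fredholm_term_scale:
  "fredholm_term K (\<lambda>x. 1 + z * f x) D n = fredholm_term K (\<lambda>x. 1 + f x) D n * z ^ n"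
proof -
  have "leibniz_det n (\<lambda>i j. ((1 + z * f (x i)) - 1) * K (x i) (x j) * indicator D (x j))
     = z ^ n * leibniz_det n (\<lambda>i j. ((1 + f (x i)) - 1) * K (x i) (x j) * indicator D (x j))" for x :: "nat \<Rightarrow> real"
    by (subst leibniz_det_scale[symmetric]) (simp add: mult_ac)
  then show ?thesis
    unfolding fredholm_term_def
    by (simp only: mult_scaleR_right[symmetric] integral_mult_right_zero) (simp only: mult_ac)
qed

section \<open>First and second moments of a linear statistic from its generating function\<close>

context
  fixes P :: "real set measure" and K :: "real \<Rightarrow> real \<Rightarrow> complex" and D :: "real set" and f :: "real \<Rightarrow> real"
  assumes det: "determinantal P K"
    and D: "D \<in> sets borel" "bounded D"
    and f: "f \<in> borel_measurable borel" "\<And>x. 0 \<le> f x" "\<And>x. f x \<le> 1" "\<forall>x. x \<notin> D \<longrightarrow> f x = 0"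
begin

lemma determinantal_generating_function:
  "(\<lambda>n. fredholm_term K (\<lambda>x. 1 + of_real (f x)) D n * z ^ n) sums (\<integral>X. (\<Prod>x\<in>X \<inter> D. 1 + z * of_real (f x)) \<partial>P)"
proof -
  have "norm (1 + z * of_real (f x)) \<le> 1 + cmod z" for x
    using f(2,3)[of x] norm_triangle_ineq[of 1 "z * of_real (f x)"] mult_left_le[of "f x" "cmod z"]
    by (simp add: norm_mult)
  then have bdd: "bounded (range (\<lambda>x. 1 + z * complex_of_real (f x)))"
    by (intro boundedI) auto
  have "(\<lambda>x. 1 + z * complex_of_real (f x)) \<in> borel_measurable borel"
    using f(1) by measurable
  with bdd have "fredholm_term K (\<lambda>x. 1 + z * of_real (f x)) D sums (\<integral>X. (\<Prod>x\<in>X \<inter> D. 1 + z * of_real (f x)) \<partial>P)"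
    using det D f(4) unfolding determinantal_def by auto
  then show ?thesis
    by (subst (asm) fredholm_term_scale[abs_def]) 
qed

text \<open>The Bochner integral of a non-integrable function is 0, so the generating function is evaluated only at
  \<open>z = - s\<close> with \<open>0 < s < 1\<close>, where the product lies in \<open>[0, 1]\<close>. Fatou then gives integrability, and
  an upper bound for the second moment, which is all that the variance estimate needs.\<close>
lemma determinantal_moments:
  defines "c \<equiv> \<lambda>n. Re (fredholm_term K (\<lambda>x. 1 + of_real (f x)) D n)"
  shows integrable_linear_statistic: "integrable P (linear_statistic D f)"
    and expectation_linear_statistic: "(\<integral>X. linear_statistic D f X \<partial>P) = c 1"
    and integrable_pair_statistic:
      "integrable P (\<lambda>X. ((linear_statistic D f X)\<^sup>2 - linear_statistic D (\<lambda>x. (f x)\<^sup>2) X) / 2)"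
    and expectation_pair_statistic:
      "(\<integral>X. ((linear_statistic D f X)\<^sup>2 - linear_statistic D (\<lambda>x. (f x)\<^sup>2) X) / 2 \<partial>P) \<le> c 2"
proof -
  let ?c = "fredholm_term K (\<lambda>x. 1 + of_real (f x)) D"
  let ?S = "linear_statistic D f" and ?Q = "linear_statistic D (\<lambda>x. (f x)\<^sup>2)"
  let ?e = "\<lambda>X. ((?S X)\<^sup>2 - ?Q X) / 2"
  have P: "prob_space P" and spP: "space P = Conf" and stP: "sets P = sets (conf_sigma UNIV)"
    using det by (auto simp: determinantal_def point_process_def)
  interpret prob_space P by (rule P)
  have meas: "linear_statistic D h \<in> borel_measurable P"
    if "h \<in> borel_measurable borel" "\<And>x. 0 \<le> h x" for h
    using measurable_linear_statistic[OF D subset_UNIV that] measurable_cong_sets[OF stP refl] by blast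
  have [measurable]: "?S \<in> borel_measurable P" "?Q \<in> borel_measurable P"
    using f by (auto intro!: meas)
  \<comment> \<open>The shift by two keeps \<open>s n\<close> strictly below 1. Then
    \<open>1 - s n * f x\<close> is positive and \<open>p n\<close> is the exponential of minus a
    linear statistic, from which its measurability follows.\<close>
  define s where "s n = inverse (real (Suc (Suc n)))" for n
  have s: "0 < s n" "s n < 1" for n
    by (auto simp: s_def divide_simps)
  have "s \<longlonglongrightarrow> 0"
    unfolding s_def by (rule LIMSEQ_Suc[OF LIMSEQ_inverse_real_of_nat])
  then have s_lim: "filterlim s (at 0) sequentially"
    using s(1) by (intro filterlim_atI) (auto simp: less_imp_neq[symmetric])
  define p where "p n X = (\<Prod>x\<in>X \<inter> D. 1 - s n * f x)" for n X
  have sf: "0 \<le> s n * f x" "s n * f x < 1" for n x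
  proof -
    have "s n * f x \<le> s n"
      using s[of n] f(3)[of x] by (intro mult_left_le) auto
    then show "s n * f x < 1"
      using s(2)[of n] by (rule order_le_less_trans)
    show "0 \<le> s n * f x"
      using s(1)[of n] f(2)[of x] by auto
  qed
  have p01: "0 \<le> p n X" "p n X \<le> 1" for n X
    unfolding p_def using sf by (auto intro!: prod_nonneg prod_le_1 simp: less_imp_le)
  have p_exp: "p n X = exp (- linear_statistic D (\<lambda>x. - ln (1 - s n * f x)) X)" if "X \<in> Conf" for n X
    using finite_Conf[OF that D(2)] sf
    by (simp add: p_def linear_statistic_def sum_negf exp_sum)
  have [measurable]: "p n \<in> borel_measurable P" for n
  proof -
    have "linear_statistic D (\<lambda>x. - ln (1 - s n * f x)) \<in> borel_measurable P"
      using f(1) sf by (intro meas) auto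
    then have "(\<lambda>X. exp (- linear_statistic D (\<lambda>x. - ln (1 - s n * f x)) X)) \<in> borel_measurable P"
      by measurable
    then show ?thesis
      by (subst measurable_cong[OF p_exp]) (auto simp: spP)
  qed
  have int_p: "integrable P (p n)" for n
    using p01 by (intro integrable_const_bound[of _ 1]) auto
  have c0: "?c 0 = 1"
  proof -
    have "(\<lambda>n. ?c n * 0 ^ n) sums 1"
      using determinantal_generating_function[of 0] prob_space by simp
    then show ?thesis
      using powser_sums_zero_iff by blast
  qed
  define G where "G z = (\<integral>X. (\<Prod>x\<in>X \<inter> D. 1 + z * complex_of_real (f x)) \<partial>P)" for z
  have G: "(\<lambda>n. ?c n * z ^ n) sums G z" for z
    unfolding G_def by (rule determinantal_generating_function)
  have G_p: "G (- of_real (s n)) = of_real (\<integral>X. p n X \<partial>P)" for n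
  proof -
    have "(\<Prod>x\<in>X \<inter> D. 1 + (- of_real (s n)) * complex_of_real (f x)) = of_real (p n X)" for X
      by (simp add: p_def)
    then show ?thesis
      unfolding G_def by (simp only: integral_complex_of_real)
  qed
  have zlim: "filterlim (\<lambda>n. - complex_of_real (s n)) (at 0) sequentially"
    using s(1) \<open>s \<longlonglongrightarrow> 0\<close>
    by (intro filterlim_atI) (auto simp: less_imp_neq[symmetric] intro!: tendsto_eq_intros)

  have "(\<lambda>n. (G (- of_real (s n)) - ?c 0) / (- of_real (s n))) \<longlonglongrightarrow> ?c 1"
    by (rule filterlim_compose[OF powser_taylor_limits(1)[OF G] zlim])
  moreover have "(G (- of_real (s n)) - ?c 0) / (- of_real (s n)) = of_real ((1 - (\<integral>X. p n X \<partial>P)) / s n)" for n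
    unfolding c0 G_p using s(1)[of n] by (simp add: field_simps)
  ultimately have lim1: "(\<lambda>n. complex_of_real ((1 - (\<integral>X. p n X \<partial>P)) / s n)) \<longlonglongrightarrow> ?c 1"
    by simp
  have "Im (?c 1) = 0"
    using tendsto_Im[OF lim1] by (simp add: LIMSEQ_const_iff)
  then have c1: "?c 1 = of_real (c 1)"
    by (simp add: complex_eq_iff c_def)
  have lim1': "(\<lambda>n. (1 - (\<integral>X. p n X \<partial>P)) / s n) \<longlonglongrightarrow> c 1"
    using tendsto_Re[OF lim1] by (simp add: c_def)
  have "(\<lambda>n. (G (- of_real (s n)) - ?c 0 - ?c 1 * (- of_real (s n))) / (- of_real (s n))\<^sup>2) \<longlonglongrightarrow> ?c 2"
    by (rule filterlim_compose[OF powser_taylor_limits(2)[OF G] zlim])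
  moreover have "(G (- of_real (s n)) - ?c 0 - ?c 1 * (- of_real (s n))) / (- of_real (s n))\<^sup>2
      = of_real (((\<integral>X. p n X \<partial>P) - 1 + s n * c 1) / (s n)\<^sup>2)" for n
    unfolding c0 c1 G_p by simp
  ultimately have "(\<lambda>n. complex_of_real (((\<integral>X. p n X \<partial>P) - 1 + s n * c 1) / (s n)\<^sup>2)) \<longlonglongrightarrow> ?c 2"
    by (simp only:)
  from tendsto_Re[OF this] have lim2: "(\<lambda>n. ((\<integral>X. p n X \<partial>P) - 1 + s n * c 1) / (s n)\<^sup>2) \<longlonglongrightarrow> c 2"
    by (simp add: c_def)

  have fatou: "integrable P h" "(\<integral>X. h X \<partial>P) \<le> l"
    if [measurable]: "h \<in> borel_measurable P" and int: "\<And>n. integrable P (u n)"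
      and nonneg: "\<And>n X. X \<in> Conf \<Longrightarrow> 0 \<le> u n X" and conv: "\<And>X. X \<in> Conf \<Longrightarrow> (\<lambda>n. u n X) \<longlonglongrightarrow> h X"
      and l: "(\<lambda>n. \<integral>X. u n X \<partial>P) \<longlonglongrightarrow> l" for u :: "nat \<Rightarrow> real set \<Rightarrow> real" and h l
  proof -
    have h0: "0 \<le> h X" if "X \<in> Conf" for X
      using conv[OF that] nonneg[OF that] by (intro LIMSEQ_le_const) auto
    have l0: "0 \<le> l"
      by (intro LIMSEQ_le_const[OF l] exI allI impI Bochner_Integration.integral_nonneg nonneg)
         (simp add: spP)
    have "(\<integral>\<^sup>+X. ennreal (h X) \<partial>P) = (\<integral>\<^sup>+X. liminf (\<lambda>n. ennreal (u n X)) \<partial>P)"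
      by (intro nn_integral_cong lim_imp_Liminf[symmetric] tendsto_ennrealI conv) (auto simp: spP)
    also have "\<dots> \<le> liminf (\<lambda>n. \<integral>\<^sup>+X. ennreal (u n X) \<partial>P)"
      using int by (intro nn_integral_liminf) auto
    also have "\<dots> = liminf (\<lambda>n. ennreal (\<integral>X. u n X \<partial>P))"
      using int nonneg by (subst nn_integral_eq_integral) (auto simp: spP)
    also have "\<dots> = ennreal l"
      by (intro lim_imp_Liminf tendsto_ennrealI l) auto
    finally have le: "(\<integral>\<^sup>+X. ennreal (h X) \<partial>P) \<le> ennreal l" .
    show int_h: "integrable P h"
      using le h0 by (intro integrableI_nonneg) (auto simp: spP intro: order_le_less_trans)
    have "ennreal (\<integral>X. h X \<partial>P) \<le> ennreal l"
      using le h0 int_h by (subst (asm) nn_integral_eq_integral) (auto simp: spP)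
    then show "(\<integral>X. h X \<partial>P) \<le> l"
      using l0 by (simp add: ennreal_le_iff)
  qed

  let ?A = "\<lambda>n X. (1 - p n X) / s n"
  \<comment> \<open>This inequality serves twice: it lets \<open>?S\<close> dominate the first-order
    quotients \<open>?A n\<close>, and it makes the second-order quotients \<open>?B n\<close>
    nonnegative, as Fatou requires.\<close>
  have p_ge: "1 - s n * ?S X \<le> p n X" if "X \<in> Conf" for n X
    using prod_one_minus_ge[OF finite_Conf[OF that D(2)], of "\<lambda>x. s n * f x"] sf
    by (simp add: p_def linear_statistic_def sum_distrib_left less_imp_le)
  have A_lim: "(\<lambda>n. ?A n X) \<longlonglongrightarrow> ?S X" if "X \<in> Conf" for X
    using filterlim_compose[OF prod_one_minus_expansion(1)[OF finite_Conf[OF that D(2)], of f] s_lim]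
    by (simp add: p_def linear_statistic_def)
  have A_int: "(\<integral>X. ?A n X \<partial>P) = (1 - (\<integral>X. p n X \<partial>P)) / s n" for n
    using int_p prob_space by simp
  show int_S: "integrable P ?S"
    by (rule fatou(1)[of _ ?A "c 1"]) (use int_p p01 s A_lim lim1' A_int prob_space in \<open>auto simp: less_imp_le\<close>)
  \<comment> \<open>Now that \<open>?S\<close> is known to be integrable it dominates its own
    approximations. The mean must be obtained exactly, since its square is subtracted in the
    variance.\<close>
  have "(\<lambda>n. \<integral>X. ?A n X \<partial>P) \<longlonglongrightarrow> (\<integral>X. ?S X \<partial>P)"
  proof (rule integral_dominated_convergence[where w = ?S])
    show "AE X in P. norm (?A n X) \<le> ?S X" for n
    proof (rule AE_I2)
      fix X assume "X \<in> space P"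
      then show "norm (?A n X) \<le> ?S X"
        using p_ge[of X n] p01[of n X] s(1)[of n] by (simp add: spP field_simps)
    qed
  qed (use A_lim int_S in \<open>auto simp: spP\<close>)
  then show mean: "(\<integral>X. ?S X \<partial>P) = c 1"
    using lim1' LIMSEQ_unique unfolding A_int by blast

  let ?B = "\<lambda>n X. (p n X - 1 + s n * ?S X) / (s n)\<^sup>2"
  have B_lim: "(\<lambda>n. ?B n X) \<longlonglongrightarrow> ?e X" if "X \<in> Conf" for X
    using filterlim_compose[OF prod_one_minus_expansion(2)[OF finite_Conf[OF that D(2)], of f] s_lim]
    by (simp add: p_def linear_statistic_def)
  have B_int: "(\<integral>X. ?B n X \<partial>P) = ((\<integral>X. p n X \<partial>P) - 1 + s n * c 1) / (s n)\<^sup>2" for n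
    using int_p int_S prob_space by (simp add: mean)
  have B_nonneg: "0 \<le> ?B n X" if "X \<in> Conf" for n X
    using p_ge[OF that, of n] by (intro divide_nonneg_nonneg) auto
  have B_integrable: "integrable P (?B n)" for n
    using int_p int_S by auto
  have e_meas: "?e \<in> borel_measurable P"
    by measurable
  note B = e_meas B_integrable B_nonneg B_lim lim2[folded B_int]
  show "integrable P ?e"
    by (rule fatou(1)[OF B])
  show "(\<integral>X. ?e X \<partial>P) \<le> c 2"
    by (rule fatou(2)[OF B])
qed

end

section \<open>Variance for reproducing kernels and rigidity\<close>

lemma leibniz_det_1: "leibniz_det 1 M = M 0 0"
proof -
  have "{p. p permutes {..<1::nat}} = {id}"
    by (auto simp: lessThan_Suc permutes_sing)
  then show ?thesis
    by (simp add: leibniz_det_def)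
qed

lemma leibniz_det_2: "leibniz_det 2 M = M 0 0 * M 1 1 - M 0 1 * M 1 0"
proof -
  have two: "{..<2::nat} = {0, 1}"
    by auto
  have perms: "{p. p permutes {0, 1::nat}} = {id, Transposition.transpose 0 1}"
    by (auto simp: permutes_doubleton_iff)
  have "id \<noteq> Transposition.transpose 0 (1::nat)"
    by (metis id_apply transpose_apply_first zero_neq_one)
  then show ?thesis
    unfolding leibniz_det_def two perms by (simp add: sign_swap_id)
qed

text \<open>Boundedness on \<open>D\<close> and finite measure give the integrability that Fubini
  asks for.\<close>

lemma integral_PiM_two:
  fixes H :: "real \<Rightarrow> real \<Rightarrow> complex"
  assumes H: "(\<lambda>z. H (fst z) (snd z)) \<in> borel_measurable (borel \<Otimes>\<^sub>M borel)"
    and bnd: "\<And>x y. x \<in> D \<Longrightarrow> y \<in> D \<Longrightarrow> cmod (H x y) \<le> M"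
    and D: "D \<in> sets borel" "bounded D"
  shows "(\<integral>x. indicator (PiE {..<2} (\<lambda>_. D)) x *\<^sub>R H (x 0) (x 1) \<partial>PiM {..<2::nat} (\<lambda>_. lborel))
     = (\<integral>x. \<integral>y. indicator D x *\<^sub>R indicator D y *\<^sub>R H x y \<partial>lborel \<partial>lborel)"
proof -
  interpret product_sigma_finite "\<lambda>_::nat. lborel :: real measure" ..
  have H' [measurable]: "(\<lambda>x. H (g x) (h x)) \<in> borel_measurable N"
    if [measurable]: "g \<in> borel_measurable N" "h \<in> borel_measurable N" for g h and N :: "'z measure"
    using measurable_compose[OF _ H, of "\<lambda>x. (g x, h x)" N] by simp
  note [measurable] = D(1)
  \<comment> \<open>Splitting off coordinate 1 makes it the inner variable and leaves coordinate 0
    outside.\<close>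
  have two: "{..<2::nat} = insert 1 {0::nat}"
    by auto
  let ?F = "\<lambda>x::nat \<Rightarrow> real. indicator (PiE {..<2} (\<lambda>_. D)) x *\<^sub>R H (x 0) (x 1)"
  have fin: "emeasure lborel D < \<infinity>"
    using D(2) emeasure_bounded_finite by auto
  have "integrable (PiM (insert 1 {0::nat}) (\<lambda>_. lborel)) ?F"
  proof (rule integrableI_bounded_set[of "PiE (insert 1 {0::nat}) (\<lambda>_. D)" _ _ M])
    show "PiE (insert 1 {0::nat}) (\<lambda>_. D) \<in> sets (PiM (insert 1 {0::nat}) (\<lambda>_. lborel))"
      using D by (intro sets_PiM_I_finite) auto
    then show "?F \<in> borel_measurable (PiM (insert 1 {0::nat}) (\<lambda>_. lborel))"
      unfolding two by measurable
    show "emeasure (PiM (insert 1 {0::nat}) (\<lambda>_. lborel)) (PiE (insert 1 {0::nat}) (\<lambda>_. D)) < \<infinity>"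
      using D fin by (subst emeasure_PiM) (auto simp: ennreal_mult_less_top)
  qed (auto simp: two PiE_iff intro!: AE_I2 bnd)
  then have "(\<integral>x. ?F x \<partial>PiM (insert 1 {0::nat}) (\<lambda>_. lborel))
      = (\<integral>x. \<integral>y. ?F (x(1 := y)) \<partial>lborel \<partial>PiM {0::nat} (\<lambda>_. lborel))"
    by (intro product_integral_insert) auto
  also have "\<dots> = (\<integral>x. (\<lambda>t. \<integral>y. indicator D t *\<^sub>R indicator D y *\<^sub>R H t y \<partial>lborel) (x 0) \<partial>PiM {0::nat} (\<lambda>_. lborel))"
  proof (intro Bochner_Integration.integral_cong refl)
    fix x :: "nat \<Rightarrow> real" and y
    assume "x \<in> space (PiM {0::nat} (\<lambda>_. lborel))"
    then have "x(1 := y) \<in> PiE {..<2} (\<lambda>_. D) \<longleftrightarrow> x 0 \<in> D \<and> y \<in> D"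
      unfolding two by (auto simp: space_PiM PiE_iff extensional_def)
    then show "?F (x(1 := y)) = indicator D (x 0) *\<^sub>R indicator D y *\<^sub>R H (x 0) y"
      by (auto simp: indicator_def)
  qed
  also have "\<dots> = (\<integral>x. \<integral>y. indicator D x *\<^sub>R indicator D y *\<^sub>R H x y \<partial>lborel \<partial>lborel)"
    by (rule product_integral_singleton) measurable
  finally show ?thesis
    unfolding two .
qed

text \<open>The \<open>reproducing\<close> axiom is the diagonal of \<open>K K = K\<close> for a
  Hermitian kernel. The axioms are pointwise and not almost everywhere, because Fredholm terms
  evaluate \<open>K\<close> on the diagonal, a null set of the plane.\<close>

locale projection_kernel =
  fixes K :: "real \<Rightarrow> real \<Rightarrow> complex"
  assumes measurable_K: "(\<lambda>z. K (fst z) (snd z)) \<in> borel_measurable (borel \<Otimes>\<^sub>M borel)"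
    and hermitian: "\<And>x y. K y x = cnj (K x y)"
    and locally_bounded: "\<And>R. \<exists>M. \<forall>x y. \<bar>x\<bar> \<le> R \<longrightarrow> \<bar>y\<bar> \<le> R \<longrightarrow> cmod (K x y) \<le> M"
    and decay: "\<And>x y. x \<noteq> y \<Longrightarrow> cmod (K x y) \<le> 1 / \<bar>x - y\<bar>"
    and diag_nonneg: "\<And>x. 0 \<le> Re (K x x)"
    and reproducing: "\<And>x. (\<integral>\<^sup>+y. ennreal ((cmod (K x y))\<^sup>2) \<partial>lborel) = ennreal (Re (K x x))"
begin

lemma measurable_K' [measurable]:
  "g \<in> borel_measurable N \<Longrightarrow> h \<in> borel_measurable N \<Longrightarrow> (\<lambda>x. K (g x) (h x)) \<in> borel_measurable N"
  using measurable_compose[OF _ measurable_K, of "\<lambda>x. (g x, h x)" N] by simp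

lemma K_diag: "K x x = of_real (Re (K x x))"
  using hermitian[of x x] by (simp add: complex_eq_iff)

text \<open>Formally the trace of \<open>f K f K\<close>: the amount by which repulsion lowers the
  expected sum over ordered pairs of distinct points.\<close>

definition pair_mass :: "(real \<Rightarrow> real) \<Rightarrow> real" where
  "pair_mass f = (\<integral>z. f (fst z) * f (snd z) * (cmod (K (fst z) (snd z)))\<^sup>2 \<partial>(lborel \<Otimes>\<^sub>M lborel))"

context
  fixes D :: "real set" and f :: "real \<Rightarrow> real"
  assumes D: "D \<in> sets borel" "bounded D"
    and f: "f \<in> borel_measurable borel" "\<And>x. 0 \<le> f x" "\<And>x. f x \<le> 1" "\<forall>x. x \<notin> D \<longrightarrow> f x = 0"
begin

lemma D_bound: "\<exists>M\<ge>0. \<forall>x\<in>D. \<forall>y\<in>D. cmod (K x y) \<le> M"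
proof -
  obtain R where "\<And>x. x \<in> D \<Longrightarrow> \<bar>x\<bar> \<le> R"
    using D(2) by (auto simp: bounded_iff)
  moreover obtain M where "\<forall>x y. \<bar>x\<bar> \<le> R \<longrightarrow> \<bar>y\<bar> \<le> R \<longrightarrow> cmod (K x y) \<le> M"
    using locally_bounded by blast
  ultimately show ?thesis
    by (intro exI[of _ "max 0 M"]) (auto simp: le_max_iff_disj)
qed

lemma emeasure_D: "emeasure lborel D < \<infinity>"
  using D(2) emeasure_bounded_finite by auto

lemma integrable_f_diag: "integrable lborel (\<lambda>x. f x * Re (K x x))"
proof -
  obtain M where M: "0 \<le> M" "\<And>x y. x \<in> D \<Longrightarrow> y \<in> D \<Longrightarrow> cmod (K x y) \<le> M"
    using D_bound by blast
  note [measurable] = f(1)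
  show ?thesis
  proof (rule integrableI_bounded_set[of D _ _ M])
    show "AE x in lborel. x \<in> D \<longrightarrow> norm (f x * Re (K x x)) \<le> M"
    proof (intro AE_I2 impI)
      fix x assume "x \<in> D"
      then have "\<bar>Re (K x x)\<bar> \<le> M"
        using M(2)[of x x] abs_Re_le_cmod[of "K x x"] by linarith
      then show "norm (f x * Re (K x x)) \<le> M"
        using f(2,3)[of x] mult_mono[of "f x" 1 "\<bar>Re (K x x)\<bar>" M] by (simp add: abs_mult)
    qed
  qed (use D emeasure_D f in auto)
qed

lemma integrable_f_f_K:
  "integrable (lborel \<Otimes>\<^sub>M lborel) (\<lambda>z. f (fst z) * f (snd z) * (cmod (K (fst z) (snd z)))\<^sup>2)"
proof -
  obtain M where M: "0 \<le> M" "\<And>x y. x \<in> D \<Longrightarrow> y \<in> D \<Longrightarrow> cmod (K x y) \<le> M"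
    using D_bound by blast
  note [measurable] = f(1)
  show ?thesis
  proof (rule integrableI_bounded_set[of "D \<times> D" _ _ "M\<^sup>2"])
    show "emeasure (lborel \<Otimes>\<^sub>M lborel) (D \<times> D) < \<infinity>"
      using D emeasure_D by (subst lborel.emeasure_pair_measure_Times) (auto simp: ennreal_mult_less_top)
    show "AE z in lborel \<Otimes>\<^sub>M lborel. z \<in> D \<times> D \<longrightarrow>
        norm (f (fst z) * f (snd z) * (cmod (K (fst z) (snd z)))\<^sup>2) \<le> M\<^sup>2"
    proof (intro AE_I2 impI)
      fix z assume "z \<in> D \<times> D"
      then have "(cmod (K (fst z) (snd z)))\<^sup>2 \<le> M\<^sup>2"
        using M(2)[of "fst z" "snd z"] by (intro power_mono) auto
      moreover have "f (fst z) * f (snd z) \<le> 1" "0 \<le> f (fst z) * f (snd z)"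
        using f(2,3) by (auto intro: mult_le_one)
      ultimately show "norm (f (fst z) * f (snd z) * (cmod (K (fst z) (snd z)))\<^sup>2) \<le> M\<^sup>2"
        using mult_mono[of "f (fst z) * f (snd z)" 1 "(cmod (K (fst z) (snd z)))\<^sup>2" "M\<^sup>2"] by simp
    qed
    show "AE z in lborel \<Otimes>\<^sub>M lborel. z \<notin> D \<times> D \<longrightarrow>
        f (fst z) * f (snd z) * (cmod (K (fst z) (snd z)))\<^sup>2 = 0"
      using f(4) by (auto simp: mem_Times_iff)
  qed (use D in measurable)
qed

lemma fredholm_term_1:
  "fredholm_term K (\<lambda>x. 1 + of_real (f x)) D 1 = of_real (\<integral>x. f x * Re (K x x) \<partial>lborel)"
proof -
  interpret product_sigma_finite "\<lambda>_::nat. lborel :: real measure" ..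
  note [measurable] = f(1)
  have one: "{..<1::nat} = {0}"
    by auto
  have "fredholm_term K (\<lambda>x. 1 + of_real (f x)) D 1 =
     (\<integral>x. (\<lambda>t. complex_of_real (f t * Re (K t t))) (x 0) \<partial>PiM {0::nat} (\<lambda>_. lborel))"
    unfolding fredholm_term_def leibniz_det_1 one
    by (auto intro!: Bochner_Integration.integral_cong simp: space_PiM PiE_iff indicator_def f(4) K_diag[symmetric])
  also have "\<dots> = (\<integral>t. complex_of_real (f t * Re (K t t)) \<partial>lborel)"
    by (rule product_integral_singleton) measurable
  finally show ?thesis
    by (simp only: integral_complex_of_real)
qed

text \<open>By Hermitian symmetry the two-by-two determinant is
  \<open>K(x,x) K(y,y) - |K(x,y)|^2\<close> times \<open>f(x) f(y)\<close>. The first part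
  factorises into the squared mean; the 2 in the denominator is the factorial of the series.\<close>

lemma fredholm_term_2:
  "fredholm_term K (\<lambda>x. 1 + of_real (f x)) D 2 = of_real (((\<integral>x. f x * Re (K x x) \<partial>lborel)\<^sup>2 - pair_mass f) / 2)"
proof -
  obtain M where M: "0 \<le> M" "\<And>x y. x \<in> D \<Longrightarrow> y \<in> D \<Longrightarrow> cmod (K x y) \<le> M"
    using D_bound by blast
  note [measurable] = f(1)
  let ?a = "\<lambda>x. f x * Re (K x x)" and ?b = "\<lambda>x y. f x * f y * (cmod (K x y))\<^sup>2"
  define A where "A = (\<integral>x. ?a x \<partial>lborel)"
  have minor: "complex_of_real (f x) * K x x * (f y * K y y) - f x * K x y * (f y * K y x)
      = of_real (?a x * ?a y - ?b x y)" for x y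
  proof -
    have "K x y * K y x = of_real ((cmod (K x y))\<^sup>2)"
      unfolding hermitian[of y x] by (simp only: complex_norm_square)
    then have "f x * K x y * (f y * K y x) = of_real (?b x y)"
      by (simp add: mult_ac)
    moreover have "complex_of_real (f x) * K x x * (f y * K y y) = of_real (?a x * ?a y)"
      by (subst (1 2) K_diag) simp
    ultimately show ?thesis
      by (simp only: of_real_diff)
  qed
  let ?H = "\<lambda>x y. complex_of_real (?a x * ?a y - ?b x y)"
  have bnd: "cmod (?H x y) \<le> 2 * M\<^sup>2" if "x \<in> D" "y \<in> D" for x y
  proof -
    have K: "cmod (f s * K s t) \<le> M" if "s \<in> D" "t \<in> D" for s t
      using M(2)[OF that] f(2,3)[of s] mult_mono[of "f s" 1 "cmod (K s t)" M] by (simp add: norm_mult)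
    have "cmod (u * v) \<le> M\<^sup>2" if "cmod u \<le> M" "cmod v \<le> M" for u v
      using that M(1) mult_mono[of "cmod u" M "cmod v" M] by (simp add: norm_mult power2_eq_square)
    then have "cmod (f x * K x x * (f y * K y y)) \<le> M\<^sup>2" "cmod (f x * K x y * (f y * K y x)) \<le> M\<^sup>2"
      using K that by auto
    then show ?thesis
      unfolding minor[symmetric] using norm_triangle_ineq4[of "f x * K x x * (f y * K y y)" "f x * K x y * (f y * K y x)"]
      by linarith
  qed
  have "fredholm_term K (\<lambda>x. 1 + of_real (f x)) D 2 =
     (1 / 2) * (\<integral>x. indicator (PiE {..<2} (\<lambda>_. D)) x *\<^sub>R ?H (x 0) (x 1) \<partial>PiM {..<2::nat} (\<lambda>_. lborel))"
    unfolding fredholm_term_def leibniz_det_2 minor[symmetric]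
    by (auto intro!: arg_cong2[of _ _ _ _ "(*)"] Bochner_Integration.integral_cong simp: PiE_iff indicator_def)
  also have "(\<integral>x. indicator (PiE {..<2} (\<lambda>_. D)) x *\<^sub>R ?H (x 0) (x 1) \<partial>PiM {..<2::nat} (\<lambda>_. lborel))
     = (\<integral>x. \<integral>y. indicator D x *\<^sub>R indicator D y *\<^sub>R ?H x y \<partial>lborel \<partial>lborel)"
    by (rule integral_PiM_two[OF _ bnd D]) measurable
  also have "\<dots> = (\<integral>x. \<integral>y. ?H x y \<partial>lborel \<partial>lborel)"
    by (intro Bochner_Integration.integral_cong refl) (auto simp: indicator_def f(4))
  also have "\<dots> = of_real (\<integral>x. \<integral>y. ?a x * ?a y - ?b x y \<partial>lborel \<partial>lborel)"
    by (simp only: integral_complex_of_real)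
  also have "(\<integral>x. \<integral>y. ?a x * ?a y - ?b x y \<partial>lborel \<partial>lborel) = (\<integral>x. ?a x * A - (\<integral>y. ?b x y \<partial>lborel) \<partial>lborel)"
  proof (intro Bochner_Integration.integral_cong refl)
    fix x
    have "integrable lborel (?b x)"
    proof (rule integrableI_bounded_set[of D _ _ "M\<^sup>2"])
      show "AE y in lborel. y \<in> D \<longrightarrow> norm (?b x y) \<le> M\<^sup>2"
      proof (intro AE_I2 impI)
        fix y assume y: "y \<in> D"
        show "norm (?b x y) \<le> M\<^sup>2"
        proof (cases "x \<in> D")
          case True
          then have "(cmod (K x y))\<^sup>2 \<le> M\<^sup>2"
            using M(2)[OF _ y] by (intro power_mono) auto
          moreover have "f x * f y \<le> 1" "0 \<le> f x * f y"
            using f(2,3) by (auto intro: mult_le_one)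
          ultimately show ?thesis
            using mult_mono[of "f x * f y" 1 "(cmod (K x y))\<^sup>2" "M\<^sup>2"] by simp
        qed (simp add: f(4))
      qed
    qed (use D emeasure_D f in auto)
    then show "(\<integral>y. ?a x * ?a y - ?b x y \<partial>lborel) = ?a x * A - (\<integral>y. ?b x y \<partial>lborel)"
      using integrable_f_diag unfolding A_def
      by (subst Bochner_Integration.integral_diff) auto
  qed
  also have "\<dots> = A\<^sup>2 - (\<integral>x. \<integral>y. ?b x y \<partial>lborel \<partial>lborel)"
    using integrable_f_diag lborel_pair.integrable_fst'[OF integrable_f_f_K]
    by (subst Bochner_Integration.integral_diff) (auto simp: A_def power2_eq_square)
  also have "(\<integral>x. \<integral>y. ?b x y \<partial>lborel \<partial>lborel) = pair_mass f"
    unfolding pair_mass_def using lborel_pair.integral_fst'[OF integrable_f_f_K] by simp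
  finally show ?thesis
    by (simp add: A_def)
qed

end

text \<open>Expand \<open>(f(x) - f(y))^2 |K(x,y)|^2\<close>: each square, integrated first in the
  variable it does not contain, gives the diagonal integral by the reproducing property, and the
  cross term gives \<open>pair_mass\<close>. Only then is \<open>|K|^2\<close> replaced by
  \<open>1 / (x - y)^2\<close>, which turns the identity into an inequality. Sums are compared
  instead of differences, as subtraction in \<open>ennreal\<close> is truncated.\<close>

lemma energy_identity:
  assumes D: "D \<in> sets borel" "bounded D"
    and f: "f \<in> borel_measurable borel" "\<And>x. 0 \<le> f x" "\<And>x. f x \<le> 1" "\<forall>x. x \<notin> D \<longrightarrow> f x = 0"
  shows "ennreal (2 * ((\<integral>x. (f x)\<^sup>2 * Re (K x x) \<partial>lborel) - pair_mass f)) \<le> energy f"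
proof -
  note [measurable] = f(1)
  let ?M = "lborel \<Otimes>\<^sub>M lborel :: (real \<times> real) measure"
  define k2 where "k2 z = (cmod (K (fst z) (snd z)))\<^sup>2" for z
  have [measurable]: "k2 \<in> borel_measurable ?M"
    unfolding k2_def by measurable
  have k2_nonneg: "0 \<le> k2 z" for z
    by (simp add: k2_def)
  define A where "A = (\<integral>x. (f x)\<^sup>2 * Re (K x x) \<partial>lborel)"
  have sq: "(f x)\<^sup>2 \<le> 1" for x
    using f(2,3)[of x] by (simp add: abs_square_le_1)
  have intA: "integrable lborel (\<lambda>x. (f x)\<^sup>2 * Re (K x x))"
    using f(2,4) sq by (intro integrable_f_diag[OF D]) auto
  have A: "(\<integral>\<^sup>+x. ennreal ((f x)\<^sup>2 * Re (K x x)) \<partial>lborel) = ennreal A" "0 \<le> A"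
    unfolding A_def using diag_nonneg intA
    by (auto intro!: nn_integral_eq_integral Bochner_Integration.integral_nonneg)
  have inner: "(\<integral>\<^sup>+y. ennreal ((f x)\<^sup>2 * (cmod (K x y))\<^sup>2) \<partial>lborel) = ennreal ((f x)\<^sup>2 * Re (K x x))" for x
    using diag_nonneg[of x] by (simp add: ennreal_mult nn_integral_cmult reproducing)
  have N1: "(\<integral>\<^sup>+z. ennreal ((f (fst z))\<^sup>2 * k2 z) \<partial>?M) = ennreal A"
    unfolding A(1)[symmetric] inner[symmetric] k2_def
    by (subst lborel.nn_integral_fst[symmetric]) auto
  have N2: "(\<integral>\<^sup>+z. ennreal ((f (snd z))\<^sup>2 * k2 z) \<partial>?M) = ennreal A"
  proof -
    have "cmod (K y x) = cmod (K x y)" for x y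
      by (subst hermitian) simp
    then have inner': "(\<integral>\<^sup>+x. ennreal ((f y)\<^sup>2 * (cmod (K x y))\<^sup>2) \<partial>lborel) = ennreal ((f y)\<^sup>2 * Re (K y y))" for y
      using inner[of y] by (metis (no_types, lifting) nn_integral_cong)
    show ?thesis
      unfolding A(1)[symmetric] inner'[symmetric] k2_def
      by (subst lborel_pair.nn_integral_snd[symmetric]) auto
  qed
  have W: "(\<integral>\<^sup>+z. ennreal (f (fst z) * f (snd z) * k2 z) \<partial>?M) = ennreal (pair_mass f)" and pm: "0 \<le> pair_mass f"
    unfolding pair_mass_def k2_def using integrable_f_f_K[OF D f] f(2)
    by (auto intro!: nn_integral_eq_integral Bochner_Integration.integral_nonneg)
  have pointwise: "ennreal ((f (fst z) - f (snd z))\<^sup>2 * k2 z) + 2 * ennreal (f (fst z) * f (snd z) * k2 z)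
     = ennreal ((f (fst z))\<^sup>2 * k2 z) + ennreal ((f (snd z))\<^sup>2 * k2 z)" for z
  proof -
    have enn: "ennreal a + 2 * ennreal b = ennreal c + ennreal d"
      if "a + 2 * b = c + d" "0 \<le> a" "0 \<le> b" "0 \<le> c" "0 \<le> d" for a b c d
    proof -
      have "ennreal a + 2 * ennreal b = ennreal (a + 2 * b)" "ennreal c + ennreal d = ennreal (c + d)"
        using that(2-) by (simp_all add: ennreal_mult')
      then show ?thesis
        using that(1) by simp
    qed
    show ?thesis
    proof (rule enn)
      show "(f (fst z) - f (snd z))\<^sup>2 * k2 z + 2 * (f (fst z) * f (snd z) * k2 z)
          = (f (fst z))\<^sup>2 * k2 z + (f (snd z))\<^sup>2 * k2 z"
        by (simp add: power2_eq_square algebra_simps)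
    qed (use k2_nonneg[of z] f(2) in auto)
  qed
  have "(\<integral>\<^sup>+z. ennreal ((f (fst z) - f (snd z))\<^sup>2 * k2 z) \<partial>?M) + 2 * ennreal (pair_mass f)
     = (\<integral>\<^sup>+z. ennreal ((f (fst z) - f (snd z))\<^sup>2 * k2 z) + 2 * ennreal (f (fst z) * f (snd z) * k2 z) \<partial>?M)"
    unfolding W[symmetric] by (subst nn_integral_add) (auto simp: nn_integral_cmult)
  also have "\<dots> = ennreal A + ennreal A"
    unfolding pointwise N1[symmetric] by (subst nn_integral_add) (auto simp: N1 N2)
  finally have eq: "(\<integral>\<^sup>+z. ennreal ((f (fst z) - f (snd z))\<^sup>2 * k2 z) \<partial>?M) + 2 * ennreal (pair_mass f)
      = ennreal A + ennreal A" .
  have "(\<integral>\<^sup>+z. ennreal ((f (fst z) - f (snd z))\<^sup>2 * k2 z) \<partial>?M) \<le> energy f"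
    unfolding energy_def
  proof (intro nn_integral_mono ennreal_leI)
    fix z :: "real \<times> real"
    show "(f (fst z) - f (snd z))\<^sup>2 * k2 z \<le> ((f (fst z) - f (snd z)) / (fst z - snd z))\<^sup>2"
    proof (cases "fst z = snd z")
      case False
      have "k2 z \<le> (1 / \<bar>fst z - snd z\<bar>)\<^sup>2"
        unfolding k2_def by (intro power_mono decay False) auto
      then have "(f (fst z) - f (snd z))\<^sup>2 * k2 z \<le> (f (fst z) - f (snd z))\<^sup>2 * (1 / \<bar>fst z - snd z\<bar>)\<^sup>2"
        by (intro mult_left_mono) auto
      then show ?thesis
        by (simp add: power_divide)
    qed simp
  qed
  then have "ennreal A + ennreal A \<le> energy f + 2 * ennreal (pair_mass f)"
    unfolding eq[symmetric] by (intro add_right_mono)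
  then have le: "ennreal (2 * A) \<le> energy f + ennreal (2 * pair_mass f)"
    using A(2) pm by (simp add: ennreal_mult' flip: ennreal_plus)
  show ?thesis
  proof (cases "energy f")
    case (real e)
    then have "2 * A \<le> e + 2 * pair_mass f"
      using le pm by (simp add: ennreal_le_iff flip: ennreal_plus)
    then show ?thesis
      using real by (auto simp: A_def intro!: ennreal_leI)
  qed simp
qed

text \<open>The square of the statistic is twice the pair sum plus the statistic of
  \<open>f^2\<close>. The squared mean contained in the pair bound cancels in the variance, and the
  first moment formula applied to \<open>f^2\<close> supplies the diagonal term.\<close>

lemma variance_linear_statistic:
  assumes det: "determinantal P K"
    and D: "D \<in> sets borel" "bounded D"
    and f: "f \<in> borel_measurable borel" "\<And>x. 0 \<le> f x" "\<And>x. f x \<le> 1" "\<forall>x. x \<notin> D \<longrightarrow> f x = 0"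
  shows "integrable P (\<lambda>X. (linear_statistic D f X - (\<integral>X. linear_statistic D f X \<partial>P))\<^sup>2)"
    and "ennreal (2 * (\<integral>X. (linear_statistic D f X - (\<integral>X. linear_statistic D f X \<partial>P))\<^sup>2 \<partial>P)) \<le> energy f"
proof -
  interpret prob_space P
    using det by (auto simp: determinantal_def point_process_def)
  let ?S = "linear_statistic D f" and ?Q = "linear_statistic D (\<lambda>x. (f x)\<^sup>2)"
  let ?A = "\<integral>x. f x * Re (K x x) \<partial>lborel" and ?A2 = "\<integral>x. (f x)\<^sup>2 * Re (K x x) \<partial>lborel"
  have f2: "(\<lambda>x. (f x)\<^sup>2) \<in> borel_measurable borel" "\<And>x. 0 \<le> (f x)\<^sup>2" "\<And>x. (f x)\<^sup>2 \<le> 1" "\<forall>x. x \<notin> D \<longrightarrow> (f x)\<^sup>2 = 0"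
    using f by (auto simp: abs_square_le_1)
  note mom = determinantal_moments[OF det D f] and mom2 = determinantal_moments[OF det D f2]
  have mean: "expectation ?S = ?A"
    unfolding mom(2) fredholm_term_1[OF D f] by simp
  have Q: "integrable P ?Q" "expectation ?Q = ?A2"
    unfolding mom2(2) fredholm_term_1[OF D f2] using mom2(1) by simp_all
  define e where "e X = ((?S X)\<^sup>2 - ?Q X) / 2" for X
  have e: "integrable P e" "expectation e \<le> (?A\<^sup>2 - pair_mass f) / 2"
    using mom(3,4) unfolding fredholm_term_2[OF D f] e_def[symmetric] by simp_all
  have S_sq: "(\<lambda>X. (?S X)\<^sup>2) = (\<lambda>X. 2 * e X + ?Q X)"
    by (simp add: fun_eq_iff e_def field_simps)
  have int_sq: "integrable P (\<lambda>X. (?S X)\<^sup>2)"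
    unfolding S_sq using e(1) Q(1) by simp
  have "expectation (\<lambda>X. (?S X)\<^sup>2) = 2 * expectation e + ?A2"
    unfolding S_sq Q(2)[symmetric] using e(1) Q(1) by simp
  then have "expectation (\<lambda>X. (?S X)\<^sup>2) \<le> ?A\<^sup>2 - pair_mass f + ?A2"
    using e(2) by simp
  then have var: "variance ?S \<le> ?A2 - pair_mass f"
    using variance_eq[OF mom(1) int_sq] mean by simp
  show "integrable P (\<lambda>X. (?S X - expectation ?S)\<^sup>2)"
    using mom(1) int_sq by (simp add: power2_diff)
  show "ennreal (2 * variance ?S) \<le> energy f"
    using var by (intro order_trans[OF ennreal_leI energy_identity[OF D f]]) simp
qed

end

text \<open>Ghosh and Peres: statistics that are constant on the bounded set and have small variance
  determine the number of points inside the set from the points outside.\<close>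
theorem (in projection_kernel) rigid:
  assumes det: "determinantal P K"
  shows "rigid P"
  unfolding rigid_def
proof (intro allI impI)
  fix B :: "real set"
  assume "B \<in> sets borel \<and> bounded B"
  then have B: "B \<in> sets borel" "bounded B"
    by auto
  have P: "prob_space P" and spP: "space P = Conf" and stP: "sets P = sets (conf_sigma UNIV)"
    using det by (auto simp: determinantal_def point_process_def)
  interpret prob_space P by (rule P)
  obtain R where R: "\<And>x. x \<in> B \<Longrightarrow> \<bar>x\<bar> \<le> R"
    using B(2) by (auto simp: bounded_iff)
  \<comment> \<open>Geometric decay makes the variances summable. The sum of all squared deviations
    is then almost surely finite, and the whole sequence of deviations tends to 0 without passing to
    a subsequence.\<close>
  have "\<exists>f. cutoff R f \<and> energy f \<le> ennreal ((1/2) ^ n)" for n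
    by (rule exists_cutoff_small_energy) simp
  then obtain f where f: "\<And>n. cutoff R (f n)" "\<And>n. energy (f n) \<le> ennreal ((1/2) ^ n)"
    by metis
  have "\<exists>T. \<forall>x. T < \<bar>x\<bar> \<longrightarrow> f n x = 0" for n
    using f(1)[of n] unfolding cutoff_def by blast
  then obtain T where T: "\<And>n x. T n < \<bar>x\<bar> \<Longrightarrow> f n x = 0"
    by metis
  have f_meas: "f n \<in> borel_measurable borel" and f01: "0 \<le> f n x" "f n x \<le> 1"
    and f1: "x \<in> B \<Longrightarrow> f n x = 1" for n x
    using f(1)[of n] R unfolding cutoff_def by auto
  define D where "D n = {- T n..T n}" for n
  have D: "D n \<in> sets borel" "bounded (D n)" and fD: "\<forall>x. x \<notin> D n \<longrightarrow> f n x = 0" for n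
    using T by (auto simp: D_def abs_le_iff not_le)
  have BD: "B \<subseteq> D n" for n
    using f1 fD[of n] by force
  define S where "S n = linear_statistic (D n) (f n)" for n
  define m where "m n = expectation (S n)" for n
  define r where "r n = linear_statistic (D n - B) (f n)" for n
  have split: "S n X = real (cnt B X) + r n X" if "X \<in> Conf" for n X
  proof -
    have eq: "X \<inter> D n = (X \<inter> B) \<union> (X \<inter> (D n - B))"
      using BD[of n] by auto
    have "S n X = (\<Sum>x\<in>X \<inter> B. f n x) + r n X"
      unfolding S_def r_def linear_statistic_def eq
      using finite_Conf[OF that B(2)] finite_Conf[OF that bounded_subset[OF D(2) Diff_subset]]
      by (intro sum.union_disjoint) auto
    also have "(\<Sum>x\<in>X \<inter> B. f n x) = real (cnt B X)"
      by (simp add: cnt_def f1)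
    finally show ?thesis .
  qed
  have r_meas: "r n \<in> borel_measurable (conf_sigma (UNIV - B))" for n
    unfolding r_def using B D f_meas f01
    by (intro measurable_linear_statistic) (auto intro: bounded_subset)
  note var = variance_linear_statistic[OF det D f_meas f01 fD, folded S_def, folded m_def]
  have [measurable]: "S n \<in> borel_measurable P" for n
    using determinantal_moments(1)[OF det D f_meas f01 fD] unfolding S_def by (rule borel_measurable_integrable)
  have var_le: "(\<integral>\<^sup>+X. ennreal ((S n X - m n)\<^sup>2) \<partial>P) \<le> ennreal ((1/2) ^ n)" for n
  proof -
    have "ennreal (\<integral>X. (S n X - m n)\<^sup>2 \<partial>P) \<le> ennreal (2 * (\<integral>X. (S n X - m n)\<^sup>2 \<partial>P))"
      by (intro ennreal_leI) simp
    also have "\<dots> \<le> ennreal ((1/2) ^ n)"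
      using var(2) f(2) by (rule order_trans)
    finally show ?thesis
      using var(1) by (subst nn_integral_eq_integral) auto
  qed
  have "(\<integral>\<^sup>+X. (\<Sum>n. ennreal ((S n X - m n)\<^sup>2)) \<partial>P) = (\<Sum>n. \<integral>\<^sup>+X. ennreal ((S n X - m n)\<^sup>2) \<partial>P)"
    by (intro nn_integral_suminf) measurable
  also have "\<dots> \<le> (\<Sum>n. ennreal ((1/2) ^ n))"
    by (intro suminf_le var_le) auto
  also have "\<dots> = ennreal (\<Sum>n. (1/2) ^ n)"
    by (intro suminf_ennreal2) auto
  finally have "(\<integral>\<^sup>+X. (\<Sum>n. ennreal ((S n X - m n)\<^sup>2)) \<partial>P) \<noteq> \<infinity>"
    by (auto simp: top_unique)
  then have "AE X in P. (\<Sum>n. ennreal ((S n X - m n)\<^sup>2)) \<noteq> \<infinity>"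
    by (intro nn_integral_noteq_infinite) measurable
  \<comment> \<open>As \<open>f n\<close> is 1 on \<open>B\<close>, the statistic \<open>S n\<close>
    is the count plus the exterior part \<open>r n\<close>. Its deviation from the constant
    \<open>m n\<close> tends to 0, so the count is recovered from exterior data alone.\<close>
  then have "AE X in P. (\<lambda>n. m n - r n X) \<longlonglongrightarrow> real (cnt B X)"
  proof (rule AE_mp, intro AE_I2 impI)
    fix X assume X: "X \<in> space P" and fin: "(\<Sum>n. ennreal ((S n X - m n)\<^sup>2)) \<noteq> \<infinity>"
    have "summable (\<lambda>n. (S n X - m n)\<^sup>2)"
      using fin by (intro summable_suminf_not_top) auto
    then have "(\<lambda>n. sqrt ((S n X - m n)\<^sup>2)) \<longlonglongrightarrow> sqrt 0"
      by (intro tendsto_real_sqrt summable_LIMSEQ_zero)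
    then have "(\<lambda>n. S n X - m n) \<longlonglongrightarrow> 0"
      by (simp add: tendsto_rabs_zero_iff)
    then have "(\<lambda>n. real (cnt B X) - (S n X - m n)) \<longlonglongrightarrow> real (cnt B X) - 0"
      by (intro tendsto_intros)
    then show "(\<lambda>n. m n - r n X) \<longlonglongrightarrow> real (cnt B X)"
      using X by (simp add: split spP)
  qed
  then obtain N where N: "{X \<in> space P. \<not> (\<lambda>n. m n - r n X) \<longlonglongrightarrow> real (cnt B X)} \<subseteq> N" "N \<in> null_sets P"
    by (auto elim!: AE_E intro: null_setsI)
  have "cnt B -` {k} \<inter> Conf \<in> completed_sets P (UNIV - B)" for k
  proof -
    \<comment> \<open>The upper limit in the extended reals exists for every configuration, so this
      exterior event is defined and measurable also where the sequence fails to converge.\<close>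
    let ?S = "{X \<in> space (conf_sigma (UNIV - B)). limsup (\<lambda>n. ereal (m n - r n X)) = ereal (real k)}"
    note [measurable] = r_meas
    have "?S \<in> sets (conf_sigma (UNIV - B))"
      by measurable
    moreover have "(cnt B -` {k} \<inter> Conf - ?S) \<union> (?S - cnt B -` {k} \<inter> Conf) \<subseteq> N"
    proof -
      have "X \<in> ?S \<longleftrightarrow> cnt B X = k" if "X \<in> Conf" "X \<notin> N" for X
      proof -
        have "(\<lambda>n. m n - r n X) \<longlonglongrightarrow> real (cnt B X)"
          using N(1) that by (auto simp: spP)
        then have "(\<lambda>n. ereal (m n - r n X)) \<longlonglongrightarrow> ereal (real (cnt B X))"
          by simp
        then have "limsup (\<lambda>n. ereal (m n - r n X)) = ereal (real (cnt B X))"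
          by (intro lim_imp_Limsup) auto
        then show ?thesis
          using that by simp
      qed
      then show ?thesis
        by auto
    qed
    ultimately show ?thesis
      using N(2) unfolding completed_sets_def by blast
  qed
  moreover have "completed_sets P (UNIV - B) \<subseteq> Pow Conf"
    by (auto simp: completed_sets_def)
  ultimately show "cnt B \<in> measurable (sigma Conf (completed_sets P (UNIV - B))) (count_space UNIV)"
    by (subst measurable_count_space_eq2_countable) (auto intro: sigma_sets.Basic)
qed

section \<open>De Branges kernels as an instance\<close>

theorem mainTheorem1:
  fixes E :: "complex \<Rightarrow> complex" and P :: "real set measure"
  assumes "de_branges_function E"
    and "determinantal P (db_kernel E)"
  shows "rigid P"
proof -
  obtain T where T: "T analytic_on {z. 0 \<le> Im z}" "\<And>z. 0 \<le> Im z \<Longrightarrow> cmod (T z) \<le> 1"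
    "\<And>x::real. cmod (T x) = 1" "\<And>x::real. E x \<noteq> 0 \<Longrightarrow> T x = sharp E x / E x"
    using de_branges_quotient[OF assms(1)] by blast
  interpret inner_function T
    using T by unfold_locales auto
  have eq: "db_kernel E x y = (if E x = 0 \<or> E y = 0 then 0 else kern x y)" for x y
    by (rule db_kernel_eq[OF assms(1) T(4)])
  have cont: "continuous_on UNIV (\<lambda>x. E (complex_of_real x))"
    using assms(1) unfolding de_branges_function_def
    by (intro continuous_on_compose2[of UNIV E, OF holomorphic_on_imp_continuous_on]) (auto intro: continuous_intros)
  then have [measurable]: "(\<lambda>x. E (complex_of_real x)) \<in> borel_measurable borel"
    by (rule borel_measurable_continuous_onI)
  note [measurable] = kern_measurable
  \<comment> \<open>\<open>db_kernel E\<close> is \<open>kern\<close> with the rows and columns at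
    real zeros of \<open>E\<close> set to 0. A zeroed row satisfies the reproducing identity as
    \<open>0 = 0\<close>; in the other rows the zeroed columns form a countable set, since a
    constant \<open>E\<close> would have the same modulus as its reflection at
    \<open>\<i>\<close>.\<close>
  have AE_E: "AE y in lborel. E (complex_of_real y) \<noteq> 0"
  proof -
    have hol: "E holomorphic_on UNIV" and lt: "cmod (sharp E \<i>) < cmod (E \<i>)"
      using assms(1) by (auto simp: de_branges_function_def)
    have "\<not> E constant_on UNIV"
    proof
      assume "E constant_on UNIV"
      then obtain c where "\<And>z. E z = c"
        by (auto simp: constant_on_def)
      with lt show False
        by (simp add: sharp_def)
    qed
    then have "countable {z. E z = 0}"
      using holomorphic_countable_zeros[of E UNIV] hol by auto
    then have "countable (complex_of_real ` {x. E (complex_of_real x) = 0})"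
      by (rule countable_subset[rotated]) auto
    then have "countable {x. E (complex_of_real x) = 0}"
      by (rule countable_image_inj_on) (simp add: inj_on_def)
    from AE_not_in[OF countable_imp_null_set_lborel[OF this]] show ?thesis
      by simp
  qed
  interpret projection_kernel "db_kernel E"
  proof
    show "(\<lambda>z. db_kernel E (fst z) (snd z)) \<in> borel_measurable (borel \<Otimes>\<^sub>M borel)"
      unfolding eq by measurable
    show "db_kernel E y x = cnj (db_kernel E x y)" for x y
      unfolding eq by (simp add: kern_hermitian[of y x])
    show "\<exists>M. \<forall>x y. \<bar>x\<bar> \<le> R \<longrightarrow> \<bar>y\<bar> \<le> R \<longrightarrow> cmod (db_kernel E x y) \<le> M" for R
    proof -
      obtain M where "\<forall>x y. \<bar>x\<bar> \<le> R \<longrightarrow> \<bar>y\<bar> \<le> R \<longrightarrow> cmod (kern x y) \<le> M"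
        using kern_locally_bounded by blast
      then show ?thesis
        unfolding eq by (intro exI[of _ "max 0 M"]) (auto simp: le_max_iff_disj)
    qed
    show "cmod (db_kernel E x y) \<le> 1 / \<bar>x - y\<bar>" if "x \<noteq> y" for x y
      unfolding eq using kern_bound[OF that] by simp
    show "0 \<le> Re (db_kernel E x x)" for x
      unfolding eq using kern_diag_nonneg by simp
    show "(\<integral>\<^sup>+y. ennreal ((cmod (db_kernel E x y))\<^sup>2) \<partial>lborel) = ennreal (Re (db_kernel E x x))" for x
    proof (cases "E x = 0")
      case False
      have "(\<integral>\<^sup>+y. ennreal ((cmod (db_kernel E x y))\<^sup>2) \<partial>lborel) = (\<integral>\<^sup>+y. ennreal ((cmod (kern x y))\<^sup>2) \<partial>lborel)"
        using AE_E False by (intro nn_integral_cong_AE) (auto simp: eq)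
      then show ?thesis
        using False by (simp add: eq kern_reproducing)
    qed (simp add: eq)
  qed
  show ?thesis
    using assms(2) by (rule rigid)
qed

end
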